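(* Let $n\ge2$, let $\mathcal{X}_{\sigma(t)}=\langle\mathcal{F},\sigma\rangle$ be a switched dynamic network on $n$ vertices arbitrarily switching among connected weighted undirected graphs, and let $\Omega$ be a predefined-time consensus function. Consider the agents $\dot x_i=u_i$, $i=1,\dots,n$, with $$u_i=\kappa_i e_i^{-1}\Omega(|e_i|),\qquad e_i=\sum_{j\in\mathcal{N}_i(\mathcal{X}_{\sigma(t)})}a_{ij}(x_j-x_i),\qquad x(t_0)=x_0\in\mathbb{R}^n .$$ If $\kappa_i>0$ for $i=1,\dots,n$, then this is a consensus algorithm with fixed-time convergence: all trajectories converge to the consensus set $\{x:x_1=\cdots=x_n\}$, and there is $T_{\max}>0$, independent of $x_0$, such that the convergence time satisfies $T(x_0)\le T_{\max}$ for all $x_0\in\mathbb{R}^n$.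
   Context: Graphs. A weighted undirected graph $\mathcal{X}$ has vertex set $\{1,\dots,n\}$, edge set $\mathcal{E}(\mathcal{X})$ (unordered pairs $ij$ of distinct vertices) and weights $a_{ij}=a_{ji}>0$ for $ij\in\mathcal{E}(\mathcal{X})$; $\mathcal{N}_i(\mathcal{X})=\{j: ij\in\mathcal{E}(\mathcal{X})\}$. Switched dynamic network. $\mathcal{X}_{\sigma(t)}=\langle\mathcal{F},\sigma\rangle$ is a finite collection $\mathcal{F}=\{\mathcal{X}_1,\dots,\mathcal{X}_r\}$ of graphs on the same vertex set together with a switching signal $\sigma:[t_0,\infty)\to\{1,\dots,r\}$, generated exogenously, piecewise constant, with a minimum dwell time between consecutive switchings (so finitely many switchings in any finite interval). The weights $a_{ij}$ are those of the currently active graph. Predefined-time consensus function. A monotonically increasing $\Omega:\mathbb{R}\to\mathbb{R}$ for which there are $\hat\Omega:\mathbb{R}_+\to\mathbb{R}_+$ (with $\mathbb{R}_+=[0,\infty)$), a non-increasing $\beta:\mathbb{N}\to(0,\infty)$ and $d\ge1$ such that: (a) for all $n\in\mathbb{N}$ and all $x=(x_1,\dots,x_n)^T$ with $x_i\in\mathbb{R}_+$, $\hat\Omega(\beta(n)\|x\|_2)\le\beta(n)^d\sum_{i=1}^n\Omega(x_i)$; (b) $\Psi(z)=z^{-1}\hat\Omega(|z|)$ has the form $\Psi(z)=\Phi(|z|)^{-1}\mathrm{sign}(z)$ with $\Phi:\mathbb{R}_+\to(0,+\infty]$, $\Phi(0)=+\infty$, $\Phi(z)<+\infty$ for $z>0$,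 and $\int_0^{+\infty}\Phi(z)\,dz=1$. Conventions. The expression $z^{-1}\Omega(|z|)$ (and $z^{-1}\hat\Omega(|z|)$) is taken to be $0$ at $z=0$. A trajectory is an absolutely continuous function $x:[t_0,\infty)\to\mathbb{R}^n$ satisfying the differential equation for almost every $t$. $T(x_0)$ denotes the time elapsed from $t_0$ until $x(t)$ reaches (in the limit) the consensus set. *)

theory Defs
  imports "HOL-Analysis.Analysis"
begin

section \<open>Weighted undirected graphs\<close>

text \<open>The vertices are all elements of a finite type. Weights of non-edges are irrelevant.\<close>

record 'v wgraph =
  edges :: "'v set set"
  weight :: "'v \<Rightarrow> 'v \<Rightarrow> real"

definition weighted_graph :: "'v wgraph \<Rightarrow> bool" where
  "weighted_graph X \<longleftrightarrow>
     (\<forall>e\<in>edges X. \<exists>i j. i \<noteq> j \<and> e = {i, j}) \<and>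
     (\<forall>i j. {i, j} \<in> edges X \<longrightarrow> weight X i j = weight X j i \<and> weight X i j > 0)"

definition neighbours :: "'v wgraph \<Rightarrow> 'v \<Rightarrow> 'v set" where
  "neighbours X i = {j. {i, j} \<in> edges X}"

definition connected_graph :: "'v wgraph \<Rightarrow> bool" where
  "connected_graph X \<longleftrightarrow> (\<forall>i j. (i, j) \<in> {(u, v). {u, v} \<in> edges X}\<^sup>*)"


section \<open>Switched dynamic networks\<close>

text \<open>
  Since \<^typ>\<open>nat\<close> is discrete, the discontinuities of \<open>\<sigma>\<close> are exactly the points at which it
  is not locally constant. The value of \<open>\<sigma>\<close> at a switching instant is left unconstrained, so
  that both one-sided conventions are covered.
\<close>

definition switching_instants :: "real \<Rightarrow> (real \<Rightarrow> nat) \<Rightarrow> real set" where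
  "switching_instants t0 \<sigma> = {t. t0 < t \<and> \<not> isCont \<sigma> t}"

definition switching_signal :: "nat \<Rightarrow> real \<Rightarrow> (real \<Rightarrow> nat) \<Rightarrow> bool" where
  "switching_signal r t0 \<sigma> \<longleftrightarrow>
     (\<forall>t\<ge>t0. \<sigma> t \<in> {1..r}) \<and>
     (\<exists>\<tau>>0. \<forall>s\<in>switching_instants t0 \<sigma>. \<forall>t\<in>switching_instants t0 \<sigma>. s < t \<longrightarrow> \<tau> \<le> t - s)"

definition switched_network ::
  "nat \<Rightarrow> (nat \<Rightarrow> 'v wgraph) \<Rightarrow> real \<Rightarrow> (real \<Rightarrow> nat) \<Rightarrow> bool" where
  "switched_network r F t0 \<sigma> \<longleftrightarrow>
     (\<forall>k\<in>{1..r}. weighted_graph (F k)) \<and> switching_signal r t0 \<sigma>"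


section \<open>Predefined-time consensus functions\<close>

text \<open>
  Maps on the half-line are represented by total functions constrained on \<open>[0, \<infinity>)\<close> only.
  Natural numbers start at 1, so \<open>\<beta> 0\<close> is unconstrained. Division by zero yields zero,
  which is the required value of \<open>z\<^sup>-\<^sup>1 \<Omega>'(\<bar>z\<bar>)\<close> at \<open>z = 0\<close>.
\<close>

definition predefined_time_consensus_function :: "(real \<Rightarrow> real) \<Rightarrow> bool" where
  "predefined_time_consensus_function \<Omega> \<longleftrightarrow>
     mono \<Omega> \<and>
     (\<exists>(\<Omega>' :: real \<Rightarrow> real) (\<beta> :: nat \<Rightarrow> real) (d :: real) (\<Phi> :: real \<Rightarrow> ennreal).
        (\<forall>z\<ge>0. \<Omega>' z \<ge> 0) \<and>
        (\<forall>n\<ge>1. \<beta> n > 0) \<and> (\<forall>m\<ge>1. \<forall>n\<ge>m. \<beta> n \<le> \<beta> m) \<and> d \<ge> 1 \<and>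
        (\<forall>n\<ge>1. \<forall>x :: nat \<Rightarrow> real. (\<forall>i\<in>{1..n}. x i \<ge> 0) \<longrightarrow>
           \<Omega>' (\<beta> n * L2_set x {1..n}) \<le> \<beta> n powr d * (\<Sum>i=1..n. \<Omega> (x i))) \<and>
        (\<forall>z. \<Omega>' \<bar>z\<bar> / z = enn2real (inverse (\<Phi> \<bar>z\<bar>)) * sgn z) \<and>
        \<Phi> 0 = \<infinity> \<and> (\<forall>z>0. 0 < \<Phi> z \<and> \<Phi> z < \<infinity>) \<and>
        (\<lambda>z. \<Phi> z * indicator {0..} z) \<in> borel_measurable lebesgue \<and>
        (\<integral>\<^sup>+z\<in>{0..}. \<Phi> z \<partial>lebesgue) = 1)"


section \<open>The closed-loop system\<close>

definition consensus_error :: "'n wgraph \<Rightarrow> real ^ 'n \<Rightarrow> 'n \<Rightarrow> real" where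
  "consensus_error X x i = (\<Sum>j\<in>neighbours X i. weight X i j * (x $ j - x $ i))"

text \<open>Again division by zero supplies the value \<open>0\<close> when the error vanishes.\<close>

definition protocol :: "(real \<Rightarrow> real) \<Rightarrow> real ^ 'n \<Rightarrow> 'n wgraph \<Rightarrow> real ^ 'n \<Rightarrow> real ^ 'n" where
  "protocol \<Omega> \<kappa> X x =
     (\<chi> i. \<kappa> $ i * (\<Omega> \<bar>consensus_error X x i\<bar> / consensus_error X x i))"

text \<open>
  In the following definition \<open>D\<close> ranges over finite families of non-overlapping compact
  intervals contained in \<open>{a..b}\<close>, with end points \<open>Inf k\<close> and \<open>Sup k\<close>.
\<close>

definition absolutely_continuous_on_interval ::
  "real \<Rightarrow> real \<Rightarrow> (real \<Rightarrow> 'a::real_normed_vector) \<Rightarrow> bool" where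
  "absolutely_continuous_on_interval a b f \<longleftrightarrow>
     (\<forall>\<epsilon>>0. \<exists>\<delta>>0. \<forall>D. D division_of (\<Union>D) \<and> \<Union>D \<subseteq> {a..b} \<and> (\<Sum>k\<in>D. Sup k - Inf k) < \<delta> \<longrightarrow>
        (\<Sum>k\<in>D. norm (f (Sup k) - f (Inf k))) < \<epsilon>)"

text \<open>
  On the unbounded interval \<open>[t0, \<infinity>)\<close>, absolute continuity means absolute continuity on every
  compact subinterval, as usual for solutions in the sense of Caratheodory.
\<close>

definition trajectory ::
  "(real \<Rightarrow> real) \<Rightarrow> real ^ 'n \<Rightarrow> (nat \<Rightarrow> 'n wgraph) \<Rightarrow> (real \<Rightarrow> nat) \<Rightarrow> real \<Rightarrow> real ^ 'n
     \<Rightarrow> (real \<Rightarrow> real ^ 'n) \<Rightarrow> bool" where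
  "trajectory \<Omega> \<kappa> F \<sigma> t0 x0 x \<longleftrightarrow>
     x t0 = x0 \<and>
     (\<forall>b\<ge>t0. absolutely_continuous_on_interval t0 b x) \<and>
     (AE t in lebesgue. t > t0 \<longrightarrow>
        (x has_vector_derivative protocol \<Omega> \<kappa> (F (\<sigma> t)) (x t)) (at t))"


section \<open>Convergence to consensus\<close>

definition consensus_set :: "(real ^ 'n) set" where
  "consensus_set = {x. \<forall>i j. x $ i = x $ j}"

definition converges_to_consensus :: "(real \<Rightarrow> real ^ 'n) \<Rightarrow> bool" where
  "converges_to_consensus x \<longleftrightarrow> ((\<lambda>t. infdist (x t) consensus_set) \<longlongrightarrow> 0) at_top"

text \<open>
  The convergence time is the elapsed time after which the trajectory is in the consensus set
  for good; it is \<open>\<infinity>\<close> if consensus is reached only asymptotically or not at all.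
\<close>

definition convergence_time :: "real \<Rightarrow> (real \<Rightarrow> real ^ 'n) \<Rightarrow> ereal" where
  "convergence_time t0 x = Inf {ereal T | T. T \<ge> 0 \<and> (\<forall>t\<ge>t0 + T. x t \<in> consensus_set)}"

end

theory Submission
  imports Defs
begin

text \<open>
  Write \<open>D\<close> for the spread of the state, the largest minus the smallest component. An agent holding
  the largest value has a nonpositive error and so does not rise; symmetrically the smallest value
  does not fall. Hence \<open>D\<close> is nonincreasing whatever graph is active (\<open>spread_nonincreasing\<close>). It
  does not satisfy a useful differential inequality, however: the error of the leading agent can be
  arbitrarily small while \<open>D\<close> is large. For a fixed graph \<open>G\<close> the energy, half the Laplacian
  quadratic form, does satisfy one, because the errors are its negative partial derivatives and it
  decreases at rate \<open>\<Sum>i. \<kappa> i * \<Omega> \<bar>e i\<bar>\<close>; but at a switching instant the energy may jump up by a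
  constant factor. The proof lets the two functions work together, on stretches of a fixed length
  \<open>T\<close> during which the graph does not change. Such stretches exist in every window of length
  \<open>2 * T\<close> if \<open>4 * T\<close> is the dwell time (\<open>constant_stretch\<close>). Two things happen in a stretch.

  First, however large \<open>D\<close> is at its beginning, at its end \<open>D\<close> is at most some constant \<open>D1\<close>; and if
  \<open>D\<close> is at most some constant \<open>D2 > 0\<close> at its beginning, then \<open>D = 0\<close> at its end
  (\<open>fixed_graph_descent\<close>). This is where the gauge \<open>\<Phi>\<close> enters. Case \<open>n = 1\<close> of the comparison of
  \<open>\<Omega>\<close> with \<open>\<Phi>\<close>, monotonicity of \<open>\<Omega>\<close>, and integrability of \<open>\<Phi>\<close> make the series over all integers
  \<open>k\<close> of \<open>(2 powi k)\<^sup>2 / \<Omega> (2 powi k)\<close> convergent (\<open>consensus_function_dyadically_summable\<close>). Its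
  terms bound, up to a constant, the time the energy needs to fall from \<open>(2 powi (k + 1))\<^sup>2\<close> to
  \<open>(2 powi k)\<^sup>2\<close>, so all sufficiently high levels together, and all sufficiently low levels together,
  are passed in less than time \<open>T\<close>.

  Secondly, \<open>D\<close> is multiplied by at most a constant \<open>1 - \<eta>\<close> (\<open>fixed_graph_contraction\<close>). The same
  series bounds \<open>\<Omega> z\<close> below by a multiple of \<open>z\<^sup>2\<close>, so an agent with error \<open>e\<close> moves at least at
  speed proportional to \<open>\<bar>e\<bar>\<close>, though possibly much faster. Fast motion is the danger: agents that
  quickly change places could keep the maximum and the minimum where they are. It is excluded by the
  energy. While \<open>\<bar>e i\<bar> \<ge> \<epsilon>\<close>, moving agent \<open>i\<close> by a distance \<open>s\<close> costs at least \<open>\<epsilon> * s\<close> of energy, and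
  a maximum principle for displacements shows that the agents with small errors cannot move far
  without the others (\<open>cheap_window_stationary\<close>). The energy at the start being at most a multiple of
  \<open>D\<^sup>2\<close>, one of many equally long parts of the stretch costs little, hence is nearly motionless. In
  this part the lowest agent stays low, and it pulls its neighbours down, these pull their neighbours
  down, and so on until the maximum has fallen by a fixed fraction of \<open>D\<close>
  (\<open>low_vertex_pulls_all_down\<close>).

  So one stretch brings \<open>D\<close> below \<open>D1\<close>, a number of stretches depending only on \<open>D1\<close>, \<open>D2\<close> and \<open>\<eta>\<close>
  brings it below \<open>D2\<close>, and one more brings it to \<open>0\<close>, where it stays.
\<close>

section \<open>Absolutely continuous functions with a sign condition on the derivative\<close>

text \<open>
  A one-sided substitute for having a derivative at most \<open>c\<close>, tested on intervals around the point.
  It also applies to the maximum of finitely many differentiable functions, which need not be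
  differentiable.
\<close>

definition grows_at_most_at :: "real \<Rightarrow> (real \<Rightarrow> real) \<Rightarrow> real \<Rightarrow> bool" where
  "grows_at_most_at c f t \<longleftrightarrow>
     (\<forall>\<epsilon>>0. \<exists>d>0. \<forall>u v. t - d < u \<and> u \<le> t \<and> t \<le> v \<and> v < t + d \<longrightarrow>
        f v - f u \<le> (c + \<epsilon>) * (v - u))"

lemma grows_at_most_at_deriv:
  assumes f: "(f has_real_derivative f') (at t)" and le: "f' \<le> c"
  shows "grows_at_most_at c f t"
  unfolding grows_at_most_at_def
proof (intro allI impI)
  fix \<epsilon> :: real assume \<epsilon>: "\<epsilon> > 0"
  have "(f has_derivative (\<lambda>h. f' * h)) (at t)"
    using f by (simp add: has_field_derivative_def)
  then obtain d where d: "d > 0"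
    and bd: "\<And>y. \<bar>y - t\<bar> < d \<Longrightarrow> \<bar>f y - f t - f' * (y - t)\<bar> \<le> \<epsilon> * \<bar>y - t\<bar>"
    using \<epsilon> unfolding has_derivative_at_alt by (auto simp: real_norm_def)
  show "\<exists>d>0. \<forall>u v. t - d < u \<and> u \<le> t \<and> t \<le> v \<and> v < t + d \<longrightarrow> f v - f u \<le> (c + \<epsilon>) * (v - u)"
  proof (intro exI[of _ d] conjI d allI impI)
    fix u v assume uv: "t - d < u \<and> u \<le> t \<and> t \<le> v \<and> v < t + d"
    have "f v - f t \<le> (f' + \<epsilon>) * (v - t)" using bd[of v] uv by (simp add: algebra_simps abs_le_iff)
    moreover have "f t - f u \<le> (f' + \<epsilon>) * (t - u)" using bd[of u] uv by (simp add: algebra_simps abs_le_iff)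
    ultimately have "f v - f u \<le> (f' + \<epsilon>) * (v - u)" by (simp add: algebra_simps)
    also have "\<dots> \<le> (c + \<epsilon>) * (v - u)" using le uv by (intro mult_right_mono) auto
    finally show "f v - f u \<le> (c + \<epsilon>) * (v - u)" .
  qed
qed

lemma absolutely_continuousE:
  assumes "absolutely_continuous_on_interval a b f" "\<epsilon> > 0"
  obtains \<delta> where "\<delta> > 0"
    and "\<forall>D. D division_of (\<Union>D) \<and> \<Union>D \<subseteq> {a..b} \<and> (\<Sum>k\<in>D. Sup k - Inf k) < \<delta> \<longrightarrow>
        (\<Sum>k\<in>D. norm (f (Sup k) - f (Inf k))) < \<epsilon>"
proof -
  from assms(1)[unfolded absolutely_continuous_on_interval_def, THEN spec, THEN mp, OF assms(2)]
  obtain \<delta> where \<delta>: "\<delta> > 0 \<and> (\<forall>D. D division_of (\<Union>D) \<and> \<Union>D \<subseteq> {a..b} \<and> (\<Sum>k\<in>D. Sup k - Inf k) < \<delta> \<longrightarrow>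
        (\<Sum>k\<in>D. norm (f (Sup k) - f (Inf k))) < \<epsilon>)"
    by (rule exE)
  show thesis
    by (rule that[OF \<delta>[THEN conjunct1]], rule \<delta>[THEN conjunct2])
qed

text \<open>
  Absolute continuity excludes growth hidden in a null set. Choose a gauge that keeps intervals
  tagged in the exceptional set inside an open set of small measure, where absolute continuity makes
  the total increment small, and that keeps the other intervals inside the range of the local
  growth bound; then add up the increments over a division that is fine for this gauge.
\<close>

lemma absolutely_continuous_growth_bound:
  fixes f :: "real \<Rightarrow> real"
  assumes ab: "a \<le> b" and ac: "absolutely_continuous_on_interval a b f" and N: "negligible N"
    and gr: "\<And>t. t \<in> {a<..<b} - N \<Longrightarrow> grows_at_most_at c f t"
  shows "f b - f a \<le> c * (b - a)"
proof (rule field_le_epsilon)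
  fix e :: real assume e: "0 < e"
  (* One \<epsilon> per unit of length for the good intervals, one for the increments over the bad
     intervals, and one for the length that the bad intervals take away. *)
  define \<epsilon> where "\<epsilon> = e / (b - a + 2)"
  have \<epsilon>: "\<epsilon> > 0" using e ab by (simp add: \<epsilon>_def)
  define N' where "N' = N \<union> {a, b}"
  have N': "negligible N'" using N by (simp add: N'_def negligible_Un negligible_finite)
  obtain \<delta> where \<delta>: "\<delta> > 0" and acD: "\<forall>D. D division_of (\<Union>D) \<and> \<Union>D \<subseteq> {a..b} \<and> (\<Sum>k\<in>D. Sup k - Inf k) < \<delta> \<longrightarrow>
        (\<Sum>k\<in>D. norm (f (Sup k) - f (Inf k))) < \<epsilon>"
    by (rule absolutely_continuousE[OF ac \<epsilon>])
  define \<eta> where "\<eta> = min \<delta> (\<epsilon> / (\<bar>c\<bar> + \<epsilon>))"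
  have \<eta>: "\<eta> > 0" using \<delta> \<epsilon> by (simp add: \<eta>_def add_nonneg_pos)
  obtain U where U: "open U" "N' \<subseteq> U" "U \<in> lmeasurable" "measure lebesgue U < \<eta>"
  proof -
    have Nm: "N' \<in> lmeasurable" "measure lebesgue N' = 0"
      using N' by (auto simp: negligible_imp_measurable negligible_imp_measure0)
    obtain U where U: "open U" "N' \<subseteq> U" "U - N' \<in> lmeasurable" "emeasure lebesgue (U - N') < ennreal \<eta>"
      by (rule sets_lebesgue_outer_open[OF fmeasurableD[OF Nm(1)] \<eta>])
    have eq: "(U - N') \<union> N' = U" using U(2) by blast
    have "U \<in> lmeasurable" using fmeasurable.Un[OF U(3) Nm(1)] unfolding eq .
    moreover have "measure lebesgue U \<le> measure lebesgue (U - N') + measure lebesgue N'"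
      using measure_Un_le[of "U - N'" lebesgue N'] U(3) Nm(1) unfolding eq by (simp add: fmeasurableD)
    moreover have "measure lebesgue (U - N') < \<eta>"
      using U(3,4) \<eta> by (simp add: emeasure_eq_measure2 ennreal_less_iff)
    ultimately show ?thesis using U Nm(2) that by simp
  qed
  have "\<forall>t. \<exists>d>0. (t \<in> N' \<longrightarrow> ball t d \<subseteq> U) \<and> (t \<in> {a..b} - N' \<longrightarrow>
      (\<forall>u v. t - d < u \<and> u \<le> t \<and> t \<le> v \<and> v < t + d \<longrightarrow> f v - f u \<le> (c + \<epsilon>) * (v - u)))"
  proof
    fix t show "\<exists>d>0. (t \<in> N' \<longrightarrow> ball t d \<subseteq> U) \<and> (t \<in> {a..b} - N' \<longrightarrow>
      (\<forall>u v. t - d < u \<and> u \<le> t \<and> t \<le> v \<and> v < t + d \<longrightarrow> f v - f u \<le> (c + \<epsilon>) * (v - u)))"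
    proof (cases "t \<in> N'")
      case True
      then obtain d where "d > 0" "ball t d \<subseteq> U" using U(1,2) by (meson open_contains_ball subsetD)
      then show ?thesis using True by (intro exI[of _ d]) auto
    next
      case F: False
      show ?thesis
      proof (cases "t \<in> {a..b}")
        case True
        then have "t \<in> {a<..<b} - N" using F by (auto simp: N'_def)
        from gr[OF this, unfolded grows_at_most_at_def, rule_format, OF \<epsilon>]
        obtain d where "d > 0" "\<forall>u v. t - d < u \<and> u \<le> t \<and> t \<le> v \<and> v < t + d \<longrightarrow> f v - f u \<le> (c + \<epsilon>) * (v - u)" by blast
        then show ?thesis using F by (intro exI[of _ d]) auto
      next
        case False
        then show ?thesis using F by (intro exI[of _ 1]) auto
      qed
    qed
  qed
  from choice[OF this] obtain d where "\<forall>t. d t > 0 \<and> (t \<in> N' \<longrightarrow> ball t (d t) \<subseteq> U) \<and> (t \<in> {a..b} - N' \<longrightarrow>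
      (\<forall>u v. t - d t < u \<and> u \<le> t \<and> t \<le> v \<and> v < t + d t \<longrightarrow> f v - f u \<le> (c + \<epsilon>) * (v - u)))"
    by blast
  note d = this[THEN spec]
  have dpos: "d t > 0" for t using d[of t] by (rule conjunct1)
  have dN: "ball t (d t) \<subseteq> U" if "t \<in> N'" for t using d[of t] that by (elim conjE) (rule mp)
  have dG: "f v - f u \<le> (c + \<epsilon>) * (v - u)"
    if "t \<in> {a..b}" "t \<notin> N'" "t - d t < u" "u \<le> t" "t \<le> v" "v < t + d t" for t u v
  proof -
    have "t \<in> {a..b} - N'" using that by simp
    then have "\<forall>u v. t - d t < u \<and> u \<le> t \<and> t \<le> v \<and> v < t + d t \<longrightarrow> f v - f u \<le> (c + \<epsilon>) * (v - u)"
      using d[of t] by (elim conjE) (rule mp)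
    then show ?thesis using that by simp
  qed
  obtain p where p: "p tagged_division_of {a..b}" and fine: "(\<lambda>t. ball t (d t)) fine p"
  proof (rule fine_division_exists_real)
    show "gauge (\<lambda>t. ball t (d t))" using dpos by (intro gauge_ball_dependent) auto
  qed
  (* The part of the division that is tagged in the exceptional set. *)
  define P where "P = {(t, k) \<in> p. t \<in> N'}"
  have Pp: "P \<subseteq> p" by (auto simp: P_def)
  have finp: "finite p" by (rule tagged_division_of_finite[OF p])
  have shape: "\<exists>u v. k = {u..v} \<and> u \<le> t \<and> t \<le> v \<and> a \<le> u \<and> v \<le> b \<and> k \<subseteq> ball t (d t)" if tk: "(t, k) \<in> p" for t k
  proof -
    obtain u v where k: "k = {u..v}" using tagged_division_ofD(4)[OF p tk] by auto
    have "t \<in> k" "k \<subseteq> {a..b}" using tagged_division_ofD(2,3)[OF p tk] by auto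
    moreover have "k \<subseteq> ball t (d t)" using fine tk by (auto simp: fine_def)
    ultimately show ?thesis using k by (intro exI[of _ u] exI[of _ v]) auto
  qed
  have tot: "(\<Sum>(t, k)\<in>p. f (Sup k) - f (Inf k)) = f b - f a"
    by (rule additive_tagged_division_1[OF ab p])
  have len: "(\<Sum>(t, k)\<in>p. Sup k - Inf k) = b - a"
    using additive_tagged_division_1[OF ab p, of "\<lambda>x. x"] by simp
  have split: "(\<Sum>z\<in>p. h z) = (\<Sum>z\<in>P. h z) + (\<Sum>z\<in>p - P. h z)" for h :: "_ \<Rightarrow> real"
    using sum.subset_diff[OF Pp finp, of h] by simp
  have Ptag: "P tagged_division_of \<Union>(snd ` P)"
  proof (rule tagged_partial_division_of_Union_self, rule tagged_partial_division_subset[OF _ Pp])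
    show "p tagged_partial_division_of {a..b}" using p by (simp add: tagged_division_of_def)
  qed
  have div: "(snd ` P) division_of \<Union>(snd ` P)"
    by (rule division_of_tagged_division[OF Ptag])
  have over: "(\<Sum>(t, k)\<in>P. h k) = (\<Sum>k\<in>snd ` P. h k)"
    if "\<And>k. measure lborel k = 0 \<Longrightarrow> k \<in> snd ` P \<Longrightarrow> h k = 0" for h :: "real set \<Rightarrow> real"
  proof -
    (* The lemma on divisions asks for a function vanishing on all degenerate boxes, so the function
       is first cut off outside the division. *)
    define h' where "h' k = (if k \<in> snd ` P then h k else 0)" for k
    have "(\<Sum>(t, k)\<in>P. h' k) = (\<Sum>k\<in>snd ` P. h' k)"
    proof (rule sum.over_tagged_division_lemma[OF Ptag])
      fix u v :: real assume "box u v = {}"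
      then have "measure lborel (cbox u v) = 0" by (simp add: content_eq_0_interior interior_cbox)
      then show "h' (cbox u v) = 0" using that[of "cbox u v"] by (auto simp: h'_def)
    qed
    moreover have "(\<Sum>(t, k)\<in>P. h' k) = (\<Sum>(t, k)\<in>P. h k)"
    proof (rule sum.cong[OF refl], clarify)
      fix t k assume "(t, k) \<in> P"
      then have "k \<in> snd ` P" by (metis image_eqI snd_conv)
      then show "h' k = h k" by (simp add: h'_def)
    qed
    moreover have "(\<Sum>k\<in>snd ` P. h' k) = (\<Sum>k\<in>snd ` P. h k)"
      by (intro sum.cong) (auto simp: h'_def)
    ultimately show ?thesis by simp
  qed
  have memP: "\<exists>t. (t, k) \<in> P" if "k \<in> snd ` P" for k
  proof -
    from that obtain z where z: "k = snd z" "z \<in> P" by (rule imageE)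
    then have "(fst z, k) \<in> P" by simp
    then show ?thesis ..
  qed
  have degen: "Sup k = Inf k" if tk: "measure lborel k = 0" "k \<in> snd ` P" for k
  proof -
    obtain t where "(t, k) \<in> p" using memP[OF tk(2)] Pp by blast
    then obtain u v where "k = {u..v}" "u \<le> t" "t \<le> v" using shape by blast
    then show ?thesis using tk(1) by auto
  qed
  have lenP: "(\<Sum>k\<in>snd ` P. Sup k - Inf k) \<le> measure lebesgue U"
  proof -
    have "(\<Sum>k\<in>snd ` P. Sup k - Inf k) = (\<Sum>k\<in>snd ` P. measure lebesgue k)"
    proof (rule sum.cong[OF refl])
      fix k assume "k \<in> snd ` P"
      then obtain t where "(t, k) \<in> p" using memP Pp by blast
      then obtain u v where "k = {u..v}" "u \<le> t" "t \<le> v" using shape by blast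
      then show "Sup k - Inf k = measure lebesgue k" by (auto simp: measure_completion)
    qed
    also have "\<dots> = measure lebesgue (\<Union>(snd ` P))"
      using content_division[OF div] .
    also have "\<dots> \<le> measure lebesgue U"
    proof (rule measure_mono_fmeasurable)
      show "\<Union>(snd ` P) \<subseteq> U"
      proof safe
        fix y t k assume "(t, k) \<in> P" "y \<in> snd (t, k)"
        then have "t \<in> N'" "k \<subseteq> ball t (d t)" "y \<in> k" using shape by (auto simp: P_def)
        then show "y \<in> U" using dN by blast
      qed
      show "\<Union>(snd ` P) \<in> sets lebesgue"
        by (rule fmeasurableD[OF lmeasurable_division[OF div]])
    qed (use U in auto)
    finally show ?thesis .
  qed
  have sub: "\<Union>(snd ` P) \<subseteq> {a..b}"
  proof (rule Union_least)
    fix k assume "k \<in> snd ` P"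
    then obtain t where "(t, k) \<in> p" using memP Pp by blast
    then show "k \<subseteq> {a..b}" by (rule tagged_division_ofD(3)[OF p])
  qed
  have badf: "(\<Sum>(t, k)\<in>P. f (Sup k) - f (Inf k)) \<le> \<epsilon>"
  proof -
    have "(\<Sum>(t, k)\<in>P. f (Sup k) - f (Inf k)) = (\<Sum>k\<in>snd ` P. f (Sup k) - f (Inf k))"
      by (rule over) (simp add: degen)
    also have "\<dots> \<le> (\<Sum>k\<in>snd ` P. norm (f (Sup k) - f (Inf k)))"
      by (intro sum_mono) simp
    also have "\<dots> \<le> \<epsilon>"
      using acD[THEN spec, THEN mp, of "snd ` P"] div sub lenP U(4) by (simp add: \<eta>_def)
    finally show ?thesis .
  qed
  have goodf: "(\<Sum>(t, k)\<in>p - P. f (Sup k) - f (Inf k)) \<le> (\<Sum>(t, k)\<in>p - P. (c + \<epsilon>) * (Sup k - Inf k))"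
  proof (rule sum_mono, clarify)
    fix t k assume tk: "(t, k) \<in> p" "(t, k) \<notin> P"
    then obtain u v where k: "k = {u..v}" "u \<le> t" "t \<le> v" "a \<le> u" "v \<le> b" "k \<subseteq> ball t (d t)" using shape by blast
    have "u \<in> k" "v \<in> k" using k by auto
    then have "t - d t < u" "v < t + d t" using k(2,3,6) by (auto simp: dist_real_def subset_iff)
    moreover have "t \<notin> N'" using tk by (auto simp: P_def)
    ultimately have "f v - f u \<le> (c + \<epsilon>) * (v - u)" using k by (intro dG[of t]) auto
    then show "f (Sup k) - f (Inf k) \<le> (c + \<epsilon>) * (Sup k - Inf k)" using k by simp
  qed
  define l where "l = (\<Sum>(t, k)\<in>P. Sup k - Inf k)"
  have l: "0 \<le> l" "l < \<eta>"
  proof -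
    have "l = (\<Sum>k\<in>snd ` P. Sup k - Inf k)" unfolding l_def by (rule over) (simp add: degen)
    then show "l < \<eta>" using lenP U(4) by simp
    show "0 \<le> l" unfolding l_def
    proof (rule sum_nonneg, clarify)
      fix t k assume "(t, k) \<in> P"
      then obtain u v where "k = {u..v}" "u \<le> t" "t \<le> v" using Pp shape by blast
      then show "0 \<le> Sup k - Inf k" by auto
    qed
  qed
  have "(\<Sum>(t, k)\<in>p - P. (c + \<epsilon>) * (Sup k - Inf k)) = (c + \<epsilon>) * (\<Sum>(t, k)\<in>p - P. Sup k - Inf k)"
    by (simp add: sum_distrib_left case_prod_unfold)
  also have "(\<Sum>(t, k)\<in>p - P. Sup k - Inf k) = b - a - l"
    using split[of "\<lambda>(t, k). Sup k - Inf k"] len by (simp add: l_def)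
  finally have "f b - f a \<le> \<epsilon> + (c + \<epsilon>) * (b - a - l)"
    using split[of "\<lambda>(t, k). f (Sup k) - f (Inf k)"] tot badf goodf by linarith
  also have "\<dots> \<le> c * (b - a) + \<epsilon> * (b - a + 2)"
  proof -
    have "- (c + \<epsilon>) * l \<le> (\<bar>c\<bar> + \<epsilon>) * l" using l \<epsilon> by (intro mult_right_mono) auto
    also have "\<dots> \<le> (\<bar>c\<bar> + \<epsilon>) * (\<epsilon> / (\<bar>c\<bar> + \<epsilon>))" using l \<epsilon> by (intro mult_left_mono) (auto simp: \<eta>_def)
    also have "\<dots> = \<epsilon>"
    proof -
      have "\<bar>c\<bar> + \<epsilon> > 0" using \<epsilon> by linarith
      then show ?thesis by simp
    qed
    finally have "0 \<le> \<epsilon> - (- (c + \<epsilon>) * l)" by simp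
    also have "\<epsilon> - (- (c + \<epsilon>) * l) = c * (b - a) + \<epsilon> * (b - a + 2) - (\<epsilon> + (c + \<epsilon>) * (b - a - l))"
      by (simp add: algebra_simps)
    finally show ?thesis by (simp only: diff_ge_0_iff_ge)
  qed
  also have "\<epsilon> * (b - a + 2) = e" using ab by (simp add: \<epsilon>_def)
  finally show "f b - f a \<le> c * (b - a) + e" .
qed

lemma absolutely_continuous_mono:
  assumes "absolutely_continuous_on_interval a b f" "a \<le> s" "t \<le> b"
  shows "absolutely_continuous_on_interval s t f"
  unfolding absolutely_continuous_on_interval_def
proof (intro allI impI)
  fix \<epsilon> :: real assume "\<epsilon> > 0"
  obtain \<delta> where \<delta>: "\<delta> > 0" and d: "\<forall>D. D division_of (\<Union>D) \<and> \<Union>D \<subseteq> {a..b} \<and> (\<Sum>k\<in>D. Sup k - Inf k) < \<delta> \<longrightarrow>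
        (\<Sum>k\<in>D. norm (f (Sup k) - f (Inf k))) < \<epsilon>"
    by (rule absolutely_continuousE[OF assms(1) \<open>\<epsilon> > 0\<close>])
  have sub: "{s..t} \<subseteq> {a..b}" using assms by auto
  show "\<exists>\<delta>>0. \<forall>D. D division_of (\<Union>D) \<and> \<Union>D \<subseteq> {s..t} \<and> (\<Sum>k\<in>D. Sup k - Inf k) < \<delta> \<longrightarrow>
        (\<Sum>k\<in>D. norm (f (Sup k) - f (Inf k))) < \<epsilon>"
  proof (intro exI[of _ \<delta>] conjI \<delta> allI impI)
    fix D assume "D division_of (\<Union>D) \<and> \<Union>D \<subseteq> {s..t} \<and> (\<Sum>k\<in>D. Sup k - Inf k) < \<delta>"
    then show "(\<Sum>k\<in>D. norm (f (Sup k) - f (Inf k))) < \<epsilon>"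
      using sub order_trans[OF _ sub] by (intro d[THEN spec, THEN mp]) simp
  qed
qed

lemma absolutely_continuous_compose:
  fixes f :: "real \<Rightarrow> 'a::real_normed_vector" and h :: "'a \<Rightarrow> 'b::real_normed_vector"
  assumes ac: "absolutely_continuous_on_interval a b f"
    and lip: "\<And>s t. \<lbrakk>s \<in> {a..b}; t \<in> {a..b}\<rbrakk> \<Longrightarrow> norm (h (f t) - h (f s)) \<le> L * norm (f t - f s)"
  shows "absolutely_continuous_on_interval a b (\<lambda>t. h (f t))"
  unfolding absolutely_continuous_on_interval_def
proof (intro allI impI)
  fix \<epsilon> :: real assume "\<epsilon> > 0"
  then have e: "\<epsilon> / (\<bar>L\<bar> + 1) > 0" by simp
  obtain \<delta> where \<delta>: "\<delta> > 0" and d: "\<forall>D. D division_of (\<Union>D) \<and> \<Union>D \<subseteq> {a..b} \<and> (\<Sum>k\<in>D. Sup k - Inf k) < \<delta> \<longrightarrow>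
        (\<Sum>k\<in>D. norm (f (Sup k) - f (Inf k))) < \<epsilon> / (\<bar>L\<bar> + 1)"
    by (rule absolutely_continuousE[OF ac e])
  show "\<exists>\<delta>>0. \<forall>D. D division_of \<Union> D \<and> \<Union> D \<subseteq> {a..b} \<and> (\<Sum>k\<in>D. Sup k - Inf k) < \<delta> \<longrightarrow>
               (\<Sum>k\<in>D. norm (h (f (Sup k)) - h (f (Inf k)))) < \<epsilon>"
  proof (intro exI[of _ \<delta>] conjI \<delta> allI impI)
    fix D assume D: "D division_of \<Union> D \<and> \<Union> D \<subseteq> {a..b} \<and> (\<Sum>k\<in>D. Sup k - Inf k) < \<delta>"
    have "norm (h (f (Sup k)) - h (f (Inf k))) \<le> (\<bar>L\<bar> + 1) * norm (f (Sup k) - f (Inf k))" if kD: "k \<in> D" for k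
    proof -
      have div: "D division_of \<Union> D" and sub: "\<Union> D \<subseteq> {a..b}" using D by auto
      obtain u v where "k = cbox u v" using division_ofD(4)[OF div kD] by blast
      then have k: "k = {u..v}" "u \<le> v" using division_ofD(3)[OF div that] by auto
      then have "u \<in> \<Union> D" "v \<in> \<Union> D" using that by auto
      then have "u \<in> {a..b}" "v \<in> {a..b}" using sub by blast+
      then have "norm (h (f (Sup k)) - h (f (Inf k))) \<le> L * norm (f (Sup k) - f (Inf k))"
        using lip k by simp
      also have "\<dots> \<le> (\<bar>L\<bar> + 1) * norm (f (Sup k) - f (Inf k))" by (intro mult_right_mono) auto
      finally show ?thesis .
    qed
    then have "(\<Sum>k\<in>D. norm (h (f (Sup k)) - h (f (Inf k)))) \<le> (\<Sum>k\<in>D. (\<bar>L\<bar> + 1) * norm (f (Sup k) - f (Inf k)))"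
      by (rule sum_mono)
    also have "\<dots> = (\<bar>L\<bar> + 1) * (\<Sum>k\<in>D. norm (f (Sup k) - f (Inf k)))" by (simp add: sum_distrib_left)
    also have "\<dots> < (\<bar>L\<bar> + 1) * (\<epsilon> / (\<bar>L\<bar> + 1))" using d[THEN spec, THEN mp, OF D] by (intro mult_strict_left_mono) auto
    finally show "(\<Sum>k\<in>D. norm (h (f (Sup k)) - h (f (Inf k)))) < \<epsilon>" by simp
  qed
qed

lemma absolutely_continuous_imp_continuous_on:
  assumes ac: "absolutely_continuous_on_interval a b f"
  shows "continuous_on {a..b} f"
  unfolding continuous_on_iff
proof (intro ballI allI impI)
  fix s \<epsilon> :: real assume s: "s \<in> {a..b}" and "\<epsilon> > 0"
  obtain \<delta> where \<delta>: "\<delta> > 0" and d: "\<forall>D. D division_of (\<Union>D) \<and> \<Union>D \<subseteq> {a..b} \<and> (\<Sum>k\<in>D. Sup k - Inf k) < \<delta> \<longrightarrow>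
        (\<Sum>k\<in>D. norm (f (Sup k) - f (Inf k))) < \<epsilon>"
    by (rule absolutely_continuousE[OF ac \<open>\<epsilon> > 0\<close>])
  have le: "norm (f v - f u) < \<epsilon>" if "u \<in> {a..b}" "v \<in> {a..b}" "u \<le> v" "v - u < \<delta>" for u v
  proof -
    have "{{u..v}} division_of \<Union>{{u..v}}" using that division_of_self[of u v] by simp
    then show ?thesis using d[THEN spec, THEN mp, of "{{u..v}}"] that by simp
  qed
  show "\<exists>d>0. \<forall>x'\<in>{a..b}. dist x' s < d \<longrightarrow> dist (f x') (f s) < \<epsilon>"
  proof (intro exI[of _ \<delta>] conjI \<delta> ballI impI)
    fix t assume t: "t \<in> {a..b}" "dist t s < \<delta>"
    show "dist (f t) (f s) < \<epsilon>"
    proof (cases "s \<le> t")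
      case True then show ?thesis using le[of s t] s t by (simp add: dist_norm)
    next
      case False then show ?thesis using le[of t s] s t by (simp add: dist_norm norm_minus_commute)
    qed
  qed
qed

section \<open>The graph Laplacian, its energy and the spread of a state\<close>

text \<open>
  Weights extended by zero to non-edges, so that all sums can run over the whole vertex type.
\<close>

definition adj :: "'n wgraph \<Rightarrow> 'n \<Rightarrow> 'n \<Rightarrow> real" where
  "adj G i j = (if {i, j} \<in> edges G then weight G i j else 0)"

definition total_weight :: "('n::finite) wgraph \<Rightarrow> real" where
  "total_weight G = (\<Sum>i\<in>UNIV. \<Sum>j\<in>UNIV. adj G i j)"

text \<open>
  Half the quadratic form of the Laplacian. Every edge occurs twice in the double sum, whence the
  denominator 4.
\<close>

definition energy :: "('n::finite) wgraph \<Rightarrow> real ^ 'n \<Rightarrow> real" where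
  "energy G x = (\<Sum>i\<in>UNIV. \<Sum>j\<in>UNIV. adj G i j * (x $ j - x $ i)\<^sup>2) / 4"

definition top_value :: "real ^ ('n::finite) \<Rightarrow> real" where
  "top_value x = Max (range (\<lambda>i. x $ i))"

definition spread :: "real ^ ('n::finite) \<Rightarrow> real" where
  "spread x = top_value x + top_value (- x)"

lemma le_top_value: "x $ i \<le> top_value x"
  unfolding top_value_def by (rule Max_ge) auto

lemma top_value_attained: "\<exists>i. x $ i = top_value x"
proof -
  have "top_value x \<in> range (\<lambda>i. x $ i)" unfolding top_value_def by (rule Max_in) auto
  then show ?thesis by auto
qed

lemma top_value_le_iff: "top_value x \<le> c \<longleftrightarrow> (\<forall>i. x $ i \<le> c)"
  by (metis le_top_value order_trans top_value_attained)

lemma diff_le_spread: "x $ i - x $ j \<le> spread x"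
  using le_top_value[of x i] le_top_value[of "- x" j] by (simp add: spread_def)

lemma spread_attained: "\<exists>i j. spread x = x $ i - x $ j \<and> x $ i = top_value x"
proof -
  obtain i j where "x $ i = top_value x" "(- x) $ j = top_value (- x)" using top_value_attained by metis
  then show ?thesis by (intro exI[of _ i] exI[of _ j]) (simp add: spread_def flip: vector_uminus_component)
qed

lemma abs_diff_le_spread: "\<bar>x $ i - x $ j\<bar> \<le> spread x"
  using diff_le_spread[of x i j] diff_le_spread[of x j i] by linarith

lemma spread_nonneg: "0 \<le> spread x"
  using diff_le_spread[of x undefined undefined] by simp

lemma spread_eq_0_iff: "spread x = 0 \<longleftrightarrow> x \<in> consensus_set"
proof
  assume 0: "spread x = 0"
  have "x $ i = x $ j" for i j using abs_diff_le_spread[of x i j] 0 by simp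
  then show "x \<in> consensus_set" by (simp add: consensus_set_def)
next
  assume "x \<in> consensus_set"
  then have "x $ i - x $ j = 0" for i j by (simp add: consensus_set_def)
  then show "spread x = 0" using spread_attained[of x] by metis
qed

lemma top_value_lipschitz: "\<bar>top_value x - top_value y\<bar> \<le> norm (x - y)"
proof -
  have "top_value x \<le> top_value y + norm (x - y)" for x y :: "real ^ 'n"
    unfolding top_value_le_iff
  proof
    fix i
    have "x $ i - y $ i \<le> norm (x - y)" using component_le_norm_cart[of "x - y" i] by simp
    then show "x $ i \<le> top_value y + norm (x - y)" using le_top_value[of y i] by simp
  qed
  from this[of x y] this[of y x] show ?thesis by (simp add: norm_minus_commute)
qed

lemma consensus_error_adj:
  "consensus_error G x i = (\<Sum>j\<in>UNIV. adj G i j * (x $ j - x $ i))"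
proof -
  have "(\<Sum>j\<in>UNIV. adj G i j * (x $ j - x $ i)) = (\<Sum>j\<in>neighbours G i. adj G i j * (x $ j - x $ i))"
    by (rule sum.mono_neutral_right) (auto simp: adj_def neighbours_def)
  also have "\<dots> = consensus_error G x i"
    unfolding consensus_error_def by (intro sum.cong) (auto simp: adj_def neighbours_def)
  finally show ?thesis by simp
qed

lemma consensus_error_uminus: "consensus_error G (- x) i = - consensus_error G x i"
  by (simp add: consensus_error_adj sum_negf[symmetric] algebra_simps)

lemma consensus_error_diff: "consensus_error G (x - y) i = consensus_error G x i - consensus_error G y i"
  by (simp add: consensus_error_adj sum_subtractf[symmetric] algebra_simps)

lemma continuous_on_consensus_error:
  assumes "continuous_on S x" shows "continuous_on S (\<lambda>t. consensus_error G (x t) i)"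
  unfolding consensus_error_adj by (intro continuous_intros assms)

lemma adj_sym: "weighted_graph G \<Longrightarrow> adj G i j = adj G j i"
  by (auto simp: adj_def weighted_graph_def insert_commute)

lemma adj_pos: "weighted_graph G \<Longrightarrow> {i, j} \<in> edges G \<Longrightarrow> 0 < adj G i j"
  by (simp add: adj_def weighted_graph_def)

lemma adj_nonneg: "weighted_graph G \<Longrightarrow> 0 \<le> adj G i j"
  by (simp add: adj_def weighted_graph_def less_imp_le)

lemma degree_le_total_weight:
  assumes "weighted_graph G" shows "(\<Sum>j\<in>UNIV. adj G i j) \<le> total_weight G"
  unfolding total_weight_def
  by (rule member_le_sum) (auto intro!: sum_nonneg adj_nonneg assms)

lemma total_weight_nonneg: "weighted_graph G \<Longrightarrow> 0 \<le> total_weight G"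
  unfolding total_weight_def by (intro sum_nonneg adj_nonneg)

lemma consensus_error_bound:
  assumes G: "weighted_graph G" and c: "\<And>j. x $ j - x $ i \<le> c" "0 \<le> c"
  shows "consensus_error G x i \<le> total_weight G * c"
proof -
  have "consensus_error G x i \<le> (\<Sum>j\<in>UNIV. adj G i j * c)"
    unfolding consensus_error_adj by (intro sum_mono mult_left_mono c adj_nonneg G)
  also have "\<dots> = (\<Sum>j\<in>UNIV. adj G i j) * c" by (simp add: sum_distrib_right)
  also have "\<dots> \<le> total_weight G * c" by (intro mult_right_mono degree_le_total_weight G c)
  finally show ?thesis .
qed

text \<open>
  Summation by parts, from the symmetry of the weights. It gives both the formula for the energy in
  terms of the errors and the derivative of the energy along a curve.
\<close>

lemma sum_times_consensus_error:
  assumes G: "weighted_graph G"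
  shows "(\<Sum>i\<in>UNIV. y $ i * consensus_error G x i) =
    - (\<Sum>i\<in>UNIV. \<Sum>j\<in>UNIV. adj G i j * (x $ j - x $ i) * (y $ j - y $ i)) / 2"
proof -
  define S where "S = (\<Sum>i\<in>UNIV. y $ i * consensus_error G x i)"
  have S1: "S = (\<Sum>i\<in>UNIV. \<Sum>j\<in>UNIV. adj G i j * (x $ j - x $ i) * y $ i)"
    unfolding S_def consensus_error_adj by (simp add: sum_distrib_left mult_ac)
  also have "\<dots> = (\<Sum>j\<in>UNIV. \<Sum>i\<in>UNIV. adj G i j * (x $ j - x $ i) * y $ i)"
    by (rule sum.swap)
  also have "\<dots> = (\<Sum>i\<in>UNIV. \<Sum>j\<in>UNIV. - (adj G i j * (x $ j - x $ i) * y $ j))"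
  proof (intro sum.cong refl)
    fix i j
    show "adj G j i * (x $ i - x $ j) * y $ j = - (adj G i j * (x $ j - x $ i) * y $ j)"
      by (simp add: adj_sym[OF G, of j i] algebra_simps)
  qed
  finally have "S + S = (\<Sum>i\<in>UNIV. \<Sum>j\<in>UNIV. - (adj G i j * (x $ j - x $ i) * y $ j)) +
      (\<Sum>i\<in>UNIV. \<Sum>j\<in>UNIV. adj G i j * (x $ j - x $ i) * y $ i)"
    using S1 by simp
  also have "\<dots> = - (\<Sum>i\<in>UNIV. \<Sum>j\<in>UNIV. adj G i j * (x $ j - x $ i) * (y $ j - y $ i))"
    by (simp add: sum.distrib[symmetric] sum_negf[symmetric] algebra_simps)
  finally show ?thesis by (simp add: S_def)
qed

lemma energy_eq:
  "weighted_graph G \<Longrightarrow> energy G x = - (\<Sum>i\<in>UNIV. x $ i * consensus_error G x i) / 2"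
  by (simp add: sum_times_consensus_error energy_def power2_eq_square mult_ac)

lemma energy_nonneg: "weighted_graph G \<Longrightarrow> 0 \<le> energy G x"
  unfolding energy_def by (intro divide_nonneg_nonneg sum_nonneg mult_nonneg_nonneg adj_nonneg) auto

lemma edge_le_energy:
  assumes G: "weighted_graph G"
  shows "adj G i j * (x $ j - x $ i)\<^sup>2 \<le> 4 * energy G x"
proof -
  have nn: "0 \<le> adj G i j * (x $ j - x $ i)\<^sup>2" for i j
    by (intro mult_nonneg_nonneg adj_nonneg G) auto
  have "adj G i j * (x $ j - x $ i)\<^sup>2 \<le> (\<Sum>j\<in>UNIV. adj G i j * (x $ j - x $ i)\<^sup>2)"
    by (rule member_le_sum) (auto intro: nn)
  also have "\<dots> \<le> (\<Sum>i\<in>UNIV. \<Sum>j\<in>UNIV. adj G i j * (x $ j - x $ i)\<^sup>2)"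
    by (rule member_le_sum) (auto intro!: sum_nonneg nn)
  finally show ?thesis by (simp add: energy_def)
qed

lemma energy_le_spread:
  assumes G: "weighted_graph G"
  shows "energy G x \<le> total_weight G * (spread x)\<^sup>2"
proof -
  have "(x $ j - x $ i)\<^sup>2 \<le> (spread x)\<^sup>2" for i j
    using abs_diff_le_spread[of x j i] spread_nonneg[of x] by (simp add: abs_le_square_iff[symmetric])
  then have "(\<Sum>i\<in>UNIV. \<Sum>j\<in>UNIV. adj G i j * (x $ j - x $ i)\<^sup>2) \<le> (\<Sum>i\<in>UNIV. \<Sum>j\<in>UNIV. adj G i j * (spread x)\<^sup>2)"
    by (intro sum_mono mult_left_mono adj_nonneg G)
  also have "\<dots> = total_weight G * (spread x)\<^sup>2" by (simp add: total_weight_def sum_distrib_right)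
  finally show ?thesis using energy_nonneg[OF G, of x] by (simp add: energy_def)
qed

text \<open>
  A Poincare inequality: the difference of two components is bounded edge by edge along a path
  between the two vertices.
\<close>

lemma spread_le_sqrt_energy:
  assumes G: "weighted_graph G" and con: "connected_graph G"
  shows "\<exists>C>0. \<forall>x :: real ^ ('n::finite). spread x \<le> C * sqrt (energy (G :: 'n wgraph) x)"
proof -
  have "\<exists>C. \<forall>x. \<bar>x $ i - x $ j\<bar> \<le> C * sqrt (energy G x)" for i j
  proof -
    have "(i, j) \<in> {(u, v). {u, v} \<in> edges G}\<^sup>*" using con by (simp add: connected_graph_def)
    then show ?thesis
    proof (induction rule: rtrancl_induct)
      case base
      show ?case by (intro exI[of _ 0]) simp
    next
      case (step k l)
      then obtain C where C: "\<And>x. \<bar>x $ i - x $ k\<bar> \<le> C * sqrt (energy G x)" by blast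
      have a: "0 < adj G k l" using step.hyps by (intro adj_pos G) auto
      have "\<bar>x $ i - x $ l\<bar> \<le> (C + sqrt (4 / adj G k l)) * sqrt (energy G x)" for x
      proof -
        have "(x $ l - x $ k)\<^sup>2 \<le> 4 / adj G k l * energy G x"
          using edge_le_energy[OF G, of k l x] a by (simp add: field_simps)
        then have "\<bar>x $ l - x $ k\<bar> \<le> sqrt (4 / adj G k l * energy G x)" by (simp add: real_le_rsqrt)
        also have "\<dots> = sqrt (4 / adj G k l) * sqrt (energy G x)" by (rule real_sqrt_mult)
        finally show ?thesis using C[of x] by (simp add: algebra_simps)
      qed
      then show ?case by blast
    qed
  qed
  then obtain C where C: "\<And>i j x. \<bar>x $ i - x $ j\<bar> \<le> C i j * sqrt (energy G x)" by metis
  define C' where "C' = (\<Sum>i\<in>UNIV. \<Sum>j\<in>UNIV. \<bar>C i j\<bar>) + 1"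
  have CC: "C i j \<le> C'" for i j
  proof -
    have "C i j \<le> (\<Sum>j\<in>UNIV. \<bar>C i j\<bar>)" using member_le_sum[of j UNIV "\<lambda>j. \<bar>C i j\<bar>"] by force
    also have "\<dots> \<le> (\<Sum>i\<in>UNIV. \<Sum>j\<in>UNIV. \<bar>C i j\<bar>)"
      by (rule member_le_sum) (auto intro: sum_nonneg)
    finally show ?thesis by (simp add: C'_def)
  qed
  have "spread x \<le> C' * sqrt (energy G x)" for x
  proof -
    obtain i j where "spread x = x $ i - x $ j" using spread_attained by blast
    then have "spread x \<le> C i j * sqrt (energy G x)" using C[of x i j] by simp
    also have "\<dots> \<le> C' * sqrt (energy G x)"
      by (intro mult_right_mono CC real_sqrt_ge_zero energy_nonneg G)
    finally show ?thesis .
  qed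
  moreover have "C' > 0" unfolding C'_def by (intro add_nonneg_pos sum_nonneg) auto
  ultimately show ?thesis by blast
qed

text \<open>
  The errors sum to zero, so the energy \<open>- (\<Sum>i. x i * e i) / 2\<close> does not change when a constant is
  subtracted from \<open>x\<close>; it is therefore at most a multiple of the spread times the largest error,
  and the spread is in turn at most a multiple of the square root of the energy.
\<close>

lemma sqrt_energy_le_error:
  assumes G: "weighted_graph G" and con: "connected_graph G"
  shows "\<exists>c>0. \<forall>x :: real ^ ('n::finite). \<exists>q. c * sqrt (energy G x) \<le> \<bar>consensus_error G x q\<bar>"
proof -
  obtain C where C: "C > 0" "\<And>x. spread x \<le> C * sqrt (energy G x)" using spread_le_sqrt_energy[OF assms] by blast
  define n where "n = real CARD('n)"
  have n: "n > 0" by (simp add: n_def)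
  have "\<exists>q. 2 / (n * C) * sqrt (energy G x) \<le> \<bar>consensus_error G x q\<bar>" for x :: "real ^ 'n"
  proof -
    define E where "E = Max (range (\<lambda>i. \<bar>consensus_error G x i\<bar>))"
    have E: "\<bar>consensus_error G x i\<bar> \<le> E" for i unfolding E_def by (rule Max_ge) auto
    have "E \<in> range (\<lambda>i. \<bar>consensus_error G x i\<bar>)" unfolding E_def by (rule Max_in) auto
    then obtain q where q: "E = \<bar>consensus_error G x q\<bar>" by blast
    define k :: 'n where "k = undefined"
    have "(\<Sum>i\<in>UNIV. x $ i * consensus_error G x i) = (\<Sum>i\<in>UNIV. (x $ i - x $ k) * consensus_error G x i)"
    proof -
      have "(\<Sum>i\<in>UNIV. consensus_error G x i) = 0"
        using sum_times_consensus_error[OF G, of "\<chi> i. 1" x] by simp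
      then show ?thesis by (simp add: algebra_simps sum_subtractf sum_distrib_left[symmetric])
    qed
    also have "\<dots> \<ge> - (\<Sum>i\<in>UNIV. \<bar>(x $ i - x $ k) * consensus_error G x i\<bar>)"
      by (subst sum_negf[symmetric]) (intro sum_mono, linarith)
    also have "- (\<Sum>i\<in>UNIV. \<bar>(x $ i - x $ k) * consensus_error G x i\<bar>) \<ge> - (\<Sum>i\<in>(UNIV :: 'n set). spread x * E)"
      unfolding neg_le_iff_le abs_mult by (intro sum_mono mult_mono abs_diff_le_spread E spread_nonneg) auto
    finally have "2 * energy G x \<le> n * spread x * E"
      by (simp add: energy_eq[OF G] n_def)
    also have "\<dots> \<le> n * (C * sqrt (energy G x)) * E"
      using n C E[of k] by (intro mult_right_mono mult_left_mono) auto
    finally have le: "2 * energy G x \<le> sqrt (energy G x) * (n * C * E)" by (simp add: mult_ac)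
    have "2 * sqrt (energy G x) \<le> n * C * E"
    proof (cases "energy G x = 0")
      case True
      then show ?thesis using n C E[of k] by simp
    next
      case False
      then have pos: "energy G x > 0" using energy_nonneg[OF G, of x] by simp
      have "sqrt (energy G x) * (2 * sqrt (energy G x)) = 2 * energy G x" using pos by simp
      with le have "sqrt (energy G x) * (2 * sqrt (energy G x)) \<le> sqrt (energy G x) * (n * C * E)" by linarith
      then show ?thesis using pos by simp
    qed
    then have "2 / (n * C) * sqrt (energy G x) \<le> E" using n C(1) by (simp add: field_simps)
    then show ?thesis using q by blast
  qed
  moreover have "2 / (n * C) > 0" using n C by simp
  ultimately show ?thesis by blast
qed

lemma spread_le_error:
  assumes G: "weighted_graph G" and con: "connected_graph G"
  shows "\<exists>c>0. \<forall>x :: real ^ ('n::finite). \<exists>q. c * spread x \<le> \<bar>consensus_error G x q\<bar>"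
proof -
  obtain C where C: "C > 0" "\<And>x. spread x \<le> C * sqrt (energy G x)" using spread_le_sqrt_energy[OF assms] by blast
  obtain c where c: "c > 0" "\<And>x. \<exists>q. c * sqrt (energy G x) \<le> \<bar>consensus_error G x q\<bar>"
    using sqrt_energy_le_error[OF assms] by blast
  have "\<exists>q. c / C * spread x \<le> \<bar>consensus_error G x q\<bar>" for x
  proof -
    have "c / C * spread x \<le> c / C * (C * sqrt (energy G x))"
      using C c by (intro mult_left_mono) auto
    also have "\<dots> = c * sqrt (energy G x)" using C(1) by simp
    finally show ?thesis using c(2)[of x] order_trans by blast
  qed
  then show ?thesis using c(1) C(1) by (intro exI[of _ "c / C"]) auto
qed

lemma energy_has_derivative:
  assumes G: "weighted_graph G" and x: "(x has_vector_derivative y) (at t)"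
  shows "((\<lambda>t. energy G (x t)) has_real_derivative - (\<Sum>i\<in>UNIV. y $ i * consensus_error G (x t) i)) (at t)"
proof -
  have xi: "((\<lambda>t. x t $ i) has_real_derivative y $ i) (at t)" for i
    using bounded_linear.has_vector_derivative[OF bounded_linear_vec_nth x]
    by (simp add: has_real_derivative_iff_has_vector_derivative)
  have "((\<lambda>t. energy G (x t)) has_real_derivative
     (\<Sum>i\<in>UNIV. \<Sum>j\<in>UNIV. adj G i j * (2 * (x t $ j - x t $ i) * (y $ j - y $ i))) / 4) (at t)"
    unfolding energy_def
    by (auto intro!: derivative_eq_intros xi sum.cong)
  moreover have "(\<Sum>i\<in>UNIV. \<Sum>j\<in>UNIV. adj G i j * (2 * (x t $ j - x t $ i) * (y $ j - y $ i))) / 4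
     = - (\<Sum>i\<in>UNIV. y $ i * consensus_error G (x t) i)"
  proof -
    have "(\<Sum>i\<in>UNIV. \<Sum>j\<in>UNIV. adj G i j * (2 * (x t $ j - x t $ i) * (y $ j - y $ i)))
       = 2 * (\<Sum>i\<in>UNIV. \<Sum>j\<in>UNIV. adj G i j * (x t $ j - x t $ i) * (y $ j - y $ i))"
      unfolding sum_distrib_left by (intro sum.cong refl) (simp add: algebra_simps)
    then show ?thesis by (simp add: sum_times_consensus_error[OF G])
  qed
  ultimately show ?thesis by simp
qed

lemma energy_lipschitz:
  assumes G: "weighted_graph G" and R: "norm x \<le> R" "norm y \<le> R"
  shows "\<bar>energy G x - energy G y\<bar> \<le> 2 * total_weight G * R * norm (x - y)"
proof -
  have "\<bar>adj G i j * (x $ j - x $ i)\<^sup>2 - adj G i j * (y $ j - y $ i)\<^sup>2\<bar> \<le> adj G i j * (4 * R * (2 * norm (x - y)))" for i j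
  proof -
    define p q where "p = x $ j - x $ i" and "q = y $ j - y $ i"
    have "\<bar>p + q\<bar> \<le> 4 * R"
      using component_le_norm_cart[of x i] component_le_norm_cart[of x j]
        component_le_norm_cart[of y i] component_le_norm_cart[of y j] R by (simp add: p_def q_def)
    moreover have "\<bar>p - q\<bar> \<le> 2 * norm (x - y)"
      using component_le_norm_cart[of "x - y" i] component_le_norm_cart[of "x - y" j] by (simp add: p_def q_def)
    ultimately have "\<bar>p + q\<bar> * \<bar>p - q\<bar> \<le> 4 * R * (2 * norm (x - y))" by (intro mult_mono) auto
    then have "\<bar>p\<^sup>2 - q\<^sup>2\<bar> \<le> 4 * R * (2 * norm (x - y))"
      by (simp add: abs_mult[symmetric] power2_eq_square algebra_simps)
    then have "adj G i j * \<bar>p\<^sup>2 - q\<^sup>2\<bar> \<le> adj G i j * (4 * R * (2 * norm (x - y)))"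
      by (intro mult_left_mono adj_nonneg G)
    then show ?thesis
      using adj_nonneg[OF G, of i j] by (simp add: p_def q_def abs_mult right_diff_distrib[symmetric])
  qed
  then have "(\<Sum>i\<in>UNIV. \<Sum>j\<in>UNIV. \<bar>adj G i j * (x $ j - x $ i)\<^sup>2 - adj G i j * (y $ j - y $ i)\<^sup>2\<bar>)
      \<le> (\<Sum>i\<in>UNIV. \<Sum>j\<in>UNIV. adj G i j * (4 * R * (2 * norm (x - y))))"
    by (intro sum_mono)
  also have "\<dots> = total_weight G * (4 * R * (2 * norm (x - y)))"
    by (simp add: total_weight_def sum_distrib_right)
  finally have 1: "(\<Sum>i\<in>UNIV. \<Sum>j\<in>UNIV. \<bar>adj G i j * (x $ j - x $ i)\<^sup>2 - adj G i j * (y $ j - y $ i)\<^sup>2\<bar>)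
      \<le> total_weight G * (4 * R * (2 * norm (x - y)))" .
  have "4 * \<bar>energy G x - energy G y\<bar> = \<bar>\<Sum>i\<in>UNIV. \<Sum>j\<in>UNIV. adj G i j * (x $ j - x $ i)\<^sup>2 - adj G i j * (y $ j - y $ i)\<^sup>2\<bar>"
    unfolding energy_def sum_subtractf by (simp flip: diff_divide_distrib)
  also have "\<dots> \<le> (\<Sum>i\<in>UNIV. \<Sum>j\<in>UNIV. \<bar>adj G i j * (x $ j - x $ i)\<^sup>2 - adj G i j * (y $ j - y $ i)\<^sup>2\<bar>)"
    by (intro order_trans[OF sum_abs] sum_mono) simp_all
  finally show ?thesis using 1 by simp
qed

section \<open>What integrability of the gauge says about a consensus function\<close>

text \<open>
  A discrete form of \<open>(\<integral>z>0. z / \<Omega> z) < \<infinity>\<close>, uniform in the starting point \<open>q\<close> of the dyadic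
  grid. For monotone \<open>\<Omega>\<close> it follows from a bound on an integral and is easier to use in estimates of
  times.
\<close>

definition dyadically_summable :: "(real \<Rightarrow> real) \<Rightarrow> real \<Rightarrow> bool" where
  "dyadically_summable \<Omega> C \<longleftrightarrow> mono \<Omega> \<and> (\<forall>z>0. \<Omega> z > 0) \<and> C > 0 \<and>
     (\<forall>q>0. \<forall>K. finite K \<longrightarrow> (\<Sum>k\<in>K. (q * 2 powi k)\<^sup>2 / \<Omega> (q * 2 powi k)) \<le> C)"

lemma disjoint_dyadic_intervals:
  assumes "q > (0::real)"
  shows "disjoint_family_on (\<lambda>k::int. {q * 2 powi k / 2 <.. q * 2 powi k}) K"
proof -
  have "{q * 2 powi k / 2 <.. q * 2 powi k} \<inter> {q * 2 powi l / 2 <.. q * 2 powi l} = {}" if "k < l" for k l :: int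
  proof -
    have "(2::real) powi (k + 1) \<le> 2 powi l" using that by (intro power_int_increasing) auto
    then have "q * 2 powi k \<le> q * 2 powi l / 2" using assms by (simp add: power_int_add)
    then show ?thesis by auto
  qed
  then have "{q * 2 powi k / 2 <.. q * 2 powi k} \<inter> {q * 2 powi l / 2 <.. q * 2 powi l} = {}" if "k \<noteq> l" for k l :: int
    using that by (metis inf_commute linorder_neqE)
  then show ?thesis by (simp add: disjoint_family_on_def)
qed

text \<open>
  Condition (a) with a single summand, combined with (b), gives \<open>\<Phi> (b * z) \<ge> c * z / \<Omega> z\<close>. By
  monotonicity of \<open>\<Omega>\<close>, \<open>\<Phi>\<close> is at least \<open>c * (q / 2) / \<Omega> q\<close> on the whole interval
  \<open>{b * q / 2 <.. b * q}\<close>. The intervals belonging to the points \<open>q * 2 powi k\<close> are disjoint, so the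
  corresponding contributions to the integral of \<open>\<Phi>\<close> add up to at most 1.
\<close>

lemma consensus_function_dyadically_summable:
  assumes "predefined_time_consensus_function \<Omega>"
  shows "\<exists>C. dyadically_summable \<Omega> C"
proof -
  from assms obtain \<Omega>' :: "real \<Rightarrow> real" and \<beta> :: "nat \<Rightarrow> real" and d :: real and \<Phi> :: "real \<Rightarrow> ennreal" where
    mono: "mono \<Omega>" and \<beta>: "\<forall>n\<ge>1. \<beta> n > 0"
    and a: "\<forall>n\<ge>1. \<forall>x :: nat \<Rightarrow> real. (\<forall>i\<in>{1..n}. x i \<ge> 0) \<longrightarrow>
           \<Omega>' (\<beta> n * L2_set x {1..n}) \<le> \<beta> n powr d * (\<Sum>i=1..n. \<Omega> (x i))"
    and \<Psi>: "\<forall>z. \<Omega>' \<bar>z\<bar> / z = enn2real (inverse (\<Phi> \<bar>z\<bar>)) * sgn z"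
    and \<Phi>: "\<forall>z>0. 0 < \<Phi> z \<and> \<Phi> z < \<infinity>"
    and int: "(\<integral>\<^sup>+z\<in>{0..}. \<Phi> z \<partial>lebesgue) = 1"
    unfolding predefined_time_consensus_function_def by (elim conjE exE)
  define b where "b = \<beta> 1"
  have b: "b > 0" using \<beta> by (simp add: b_def)
  define p where "p = b powr d"
  have p: "p > 0" using b by (simp add: p_def)
  have a1: "\<Omega>' (b * z) \<le> p * \<Omega> z" if "z \<ge> 0" for z
    using a[THEN spec[of _ 1], THEN mp, THEN spec[of _ "\<lambda>_. z"]] that by (simp add: b_def p_def L2_set_def)
  have \<Phi>': "0 < enn2real (\<Phi> y) \<and> \<Omega>' y = y / enn2real (\<Phi> y) \<and> \<Phi> y = ennreal (enn2real (\<Phi> y))" if "y > 0" for y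
  proof -
    have fin: "0 < \<Phi> y" "\<Phi> y < top" using \<Phi> that by auto
    obtain r where r: "\<Phi> y = ennreal r" "0 \<le> r" using fin(2) by (cases "\<Phi> y") auto
    then have r0: "r > 0" using fin(1) by (cases "r = 0") auto
    have "\<Omega>' y / y = enn2real (inverse (\<Phi> y))" using \<Psi>[THEN spec[of _ y]] that by simp
    also have "\<dots> = inverse r" using r0 r by (simp add: inverse_ennreal)
    finally show ?thesis using r r0 that by (simp add: field_simps)
  qed
  have pos: "\<Omega> z > 0" if "z > 0" for z
  proof -
    have "0 < \<Omega>' (b * z)" using \<Phi>'[of "b * z"] b that by simp
    also have "\<dots> \<le> p * \<Omega> z" using a1 that by simp
    finally show ?thesis using p by (simp add: zero_less_mult_iff)
  qed
  have lower: "b / p * (q / 2 / \<Omega> q) \<le> enn2real (\<Phi> y)" if "q > 0" "b * q / 2 < y" "y \<le> b * q" for q y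
  proof -
    have y: "y > 0" using that b by (smt (verit) divide_pos_pos mult_pos_pos)
    have "\<Omega>' y \<le> p * \<Omega> (y / b)" using a1[of "y / b"] y b by simp
    also have "\<dots> \<le> p * \<Omega> q" using p that b by (intro mult_left_mono monoD[OF mono]) (auto simp: field_simps)
    finally have "y / enn2real (\<Phi> y) \<le> p * \<Omega> q" using \<Phi>'[OF y] by simp
    then have "y \<le> p * \<Omega> q * enn2real (\<Phi> y)" using \<Phi>'[OF y] by (simp add: field_simps)
    then have "b * q / 2 \<le> p * \<Omega> q * enn2real (\<Phi> y)" using that by simp
    then show ?thesis using p pos[OF that(1)] by (simp add: field_simps)
  qed
  define C where "C = 4 * p / b\<^sup>2"
  have "(\<Sum>k\<in>K. (q * 2 powi k)\<^sup>2 / \<Omega> (q * 2 powi k)) \<le> C" if q: "q > 0" and K: "finite K" for q :: real and K :: "int set"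
  proof -
    define s where "s k = q * 2 powi k" for k :: int
    have s: "s k > 0" for k using q by (simp add: s_def)
    define h where "h k = b / p * (s k / 2 / \<Omega> (s k))" for k
    have h: "h k \<ge> 0" for k using b p s[of k] pos[OF s[of k]] by (simp add: h_def)
    define I where "I = (\<lambda>k. {b * s k / 2 <.. b * s k})"
    have disj: "disjoint_family_on I K"
      using disjoint_dyadic_intervals[of "b * q" K] b q by (simp add: I_def s_def mult.assoc)
    have le: "(\<Sum>k\<in>K. ennreal (h k) * indicator (I k) y) \<le> \<Phi> y * indicator {0..} y" for y
    proof (cases "\<exists>k\<in>K. y \<in> I k")
      case True
      then obtain k where k: "k \<in> K" "y \<in> I k" by blast
      have "(\<Sum>l\<in>K. ennreal (h l) * indicator (I l) y) = (\<Sum>l\<in>{k}. ennreal (h l) * indicator (I l) y)"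
      proof (rule sum.mono_neutral_right[OF K])
        show "\<forall>l\<in>K - {k}. ennreal (h l) * indicator (I l) y = 0"
        proof
          fix l assume "l \<in> K - {k}"
          then have "I l \<inter> I k = {}" using disj k(1) by (auto simp: disjoint_family_on_def)
          then show "ennreal (h l) * indicator (I l) y = 0" using k(2) by (auto simp: indicator_def)
        qed
      qed (use k in auto)
      also have "\<dots> = ennreal (h k)" using k by simp
      also have "\<dots> \<le> ennreal (enn2real (\<Phi> y))"
        unfolding h_def using k(2) s[of k] by (intro ennreal_leI lower) (auto simp: I_def)
      also have y: "y > 0"
      proof -
        have "b * s k > 0" using b s by simp
        then show ?thesis using k(2) by (auto simp: I_def)
      qed
      then have "ennreal (enn2real (\<Phi> y)) = \<Phi> y * indicator {0..} y" using \<Phi>'[of y] by simp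
      finally show ?thesis .
    next
      case False
      then have "(\<Sum>k\<in>K. ennreal (h k) * indicator (I k) y) = 0"
        by (intro sum.neutral) (auto simp: indicator_def)
      then show ?thesis by simp
    qed
    have "ennreal (\<Sum>k\<in>K. h k * (b * s k / 2)) = (\<Sum>k\<in>K. ennreal (h k * (b * s k / 2)))"
      using h b s by (subst sum_ennreal) (auto intro!: mult_nonneg_nonneg simp: less_imp_le)
    also have "\<dots> = (\<Sum>k\<in>K. \<integral>\<^sup>+y. ennreal (h k) * indicator (I k) y \<partial>lebesgue)"
    proof (intro sum.cong refl)
      fix k
      have bs: "0 < b * s k" using b s by simp
      have "I k \<in> sets lborel" by (simp add: I_def)
      then have "I k \<in> sets lebesgue" by blast
      then have "(\<integral>\<^sup>+y. ennreal (h k) * indicator (I k) y \<partial>lebesgue) = ennreal (h k) * emeasure lebesgue (I k)"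
        by (simp add: nn_integral_cmult_indicator)
      also have "emeasure lebesgue (I k) = ennreal (b * s k / 2)"
        using bs \<open>I k \<in> sets lborel\<close> by (simp add: I_def)
      also have "ennreal (h k) * ennreal (b * s k / 2) = ennreal (h k * (b * s k / 2))"
        by (rule ennreal_mult[symmetric]) (use h bs in simp_all)
      finally show "ennreal (h k * (b * s k / 2)) = (\<integral>\<^sup>+y. ennreal (h k) * indicator (I k) y \<partial>lebesgue)" by simp
    qed
    also have "\<dots> = (\<integral>\<^sup>+y. (\<Sum>k\<in>K. ennreal (h k) * indicator (I k) y) \<partial>lebesgue)"
    proof (rule nn_integral_sum[symmetric])
      fix k
      have "I k \<in> sets lborel" by (simp add: I_def)
      then have "I k \<in> sets lebesgue" by blast
      then show "(\<lambda>y. ennreal (h k) * indicator (I k) y) \<in> borel_measurable lebesgue" by measurable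
    qed
    also have "\<dots> \<le> (\<integral>\<^sup>+y\<in>{0..}. \<Phi> y \<partial>lebesgue)" by (intro nn_integral_mono le)
    also have "\<dots> = 1" by (rule int)
    finally have "(\<Sum>k\<in>K. h k * (b * s k / 2)) \<le> 1" by (simp add: ennreal_le_1)
    moreover have "h k * (b * s k / 2) = (s k)\<^sup>2 / \<Omega> (s k) / C" for k
      using b p by (simp add: h_def C_def power2_eq_square mult_ac)
    ultimately have "(\<Sum>k\<in>K. (s k)\<^sup>2 / \<Omega> (s k)) / C \<le> 1" by (simp add: sum_divide_distrib)
    moreover have "C > 0" using p b by (simp add: C_def)
    ultimately show ?thesis by (simp add: s_def)
  qed
  moreover have "C > 0" using p b by (simp add: C_def)
  ultimately show ?thesis using mono pos unfolding dyadically_summable_def by blast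
qed

text \<open>
  A single term of the series, on the grid that starts at \<open>z\<close> itself, is bounded by the sum.
\<close>

lemma dyadically_summable_quadratic:
  assumes "dyadically_summable \<Omega> C" "z > 0"
  shows "z\<^sup>2 / C \<le> \<Omega> z"
proof -
  have "\<forall>K. finite K \<longrightarrow> (\<Sum>k\<in>K. (z * 2 powi k)\<^sup>2 / \<Omega> (z * 2 powi k)) \<le> C"
    using assms unfolding dyadically_summable_def by blast
  from this[THEN spec[of _ "{0}"]] have "z\<^sup>2 / \<Omega> z \<le> C" by simp
  moreover have "\<Omega> z > 0" "C > 0" using assms unfolding dyadically_summable_def by auto
  ultimately show ?thesis by (simp add: field_simps)
qed

section \<open>Solutions: the maximum principle and the decay of the energy\<close>

text \<open>
  The graph may depend on time, so that one notion covers both a trajectory of the switched network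
  and the motion on a stretch where the graph is constant. The equation is required only in the open
  interval, which leaves the value of the signal at switching instants free.
\<close>

definition solution_on ::
  "(real \<Rightarrow> real) \<Rightarrow> real ^ 'n \<Rightarrow> (real \<Rightarrow> ('n::finite) wgraph) \<Rightarrow> real \<Rightarrow> real \<Rightarrow> (real \<Rightarrow> real ^ 'n) \<Rightarrow> bool" where
  "solution_on \<Omega> \<kappa> X a b x \<longleftrightarrow> absolutely_continuous_on_interval a b x \<and>
     (\<exists>N. negligible N \<and>
        (\<forall>t\<in>{a<..<b} - N. (x has_vector_derivative protocol \<Omega> \<kappa> (X t) (x t)) (at t)))"

lemma trajectory_solution_on:
  assumes x: "trajectory \<Omega> \<kappa> F \<sigma> t0 x0 x" and ab: "t0 \<le> a" "a \<le> b"
  shows "solution_on \<Omega> \<kappa> (\<lambda>t. F (\<sigma> t)) a b x"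
proof -
  have ac: "absolutely_continuous_on_interval a b x"
    using x ab absolutely_continuous_mono[of t0 b x a b] unfolding trajectory_def by auto
  have "AE t in lebesgue. t > t0 \<longrightarrow> (x has_vector_derivative protocol \<Omega> \<kappa> (F (\<sigma> t)) (x t)) (at t)"
    using x unfolding trajectory_def by blast
  then obtain N where N: "N \<in> null_sets lebesgue"
    "{t \<in> space lebesgue. \<not> (t > t0 \<longrightarrow> (x has_vector_derivative protocol \<Omega> \<kappa> (F (\<sigma> t)) (x t)) (at t))} \<subseteq> N"
    unfolding eventually_ae_filter by blast
  have "negligible N" using N(1) by (simp add: negligible_iff_null_sets)
  moreover have "(x has_vector_derivative protocol \<Omega> \<kappa> (F (\<sigma> t)) (x t)) (at t)" if "t \<in> {a<..<b} - N" for t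
  proof -
    have "t > t0" using that ab by auto
    moreover have "t \<notin> {t \<in> space lebesgue. \<not> (t > t0 \<longrightarrow> (x has_vector_derivative protocol \<Omega> \<kappa> (F (\<sigma> t)) (x t)) (at t))}"
      using N(2) that by blast
    ultimately show ?thesis by simp
  qed
  ultimately show ?thesis using ac unfolding solution_on_def by blast
qed

lemma solution_on_subinterval:
  assumes x: "solution_on \<Omega> \<kappa> X a b x" and st: "a \<le> s" "t \<le> b"
  shows "solution_on \<Omega> \<kappa> X s t x"
proof -
  have "absolutely_continuous_on_interval s t x"
    using x st absolutely_continuous_mono unfolding solution_on_def by blast
  moreover from x obtain N where "negligible N"
    "\<forall>t\<in>{a<..<b} - N. (x has_vector_derivative protocol \<Omega> \<kappa> (X t) (x t)) (at t)"
    unfolding solution_on_def by blast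
  ultimately show ?thesis using st unfolding solution_on_def by (intro conjI exI[of _ N]) auto
qed

lemma solution_on_cong:
  assumes "solution_on \<Omega> \<kappa> X a b x" "\<And>t. t \<in> {a<..<b} \<Longrightarrow> X t = Y t"
  shows "solution_on \<Omega> \<kappa> Y a b x"
  using assms unfolding solution_on_def by auto

lemma solution_on_uminus:
  assumes x: "solution_on \<Omega> \<kappa> X a b x"
  shows "solution_on \<Omega> \<kappa> X a b (\<lambda>t. - x t)"
proof -
  have "absolutely_continuous_on_interval a b x" using x by (simp add: solution_on_def)
  then have "absolutely_continuous_on_interval a b (\<lambda>t. - x t)"
    by (rule absolutely_continuous_compose[where L = 1]) (simp add: norm_minus_commute)
  moreover from x obtain N where N: "negligible N"
    "\<forall>t\<in>{a<..<b} - N. (x has_vector_derivative protocol \<Omega> \<kappa> (X t) (x t)) (at t)"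
    unfolding solution_on_def by blast
  moreover have "protocol \<Omega> \<kappa> G (- z) = - protocol \<Omega> \<kappa> G z" for G z
    by (simp add: protocol_def vec_eq_iff consensus_error_uminus)
  ultimately show ?thesis
    unfolding solution_on_def by (auto intro!: exI[of _ N] has_vector_derivative_minus)
qed

lemma solution_on_continuous:
  "solution_on \<Omega> \<kappa> X a b x \<Longrightarrow> continuous_on {a..b} x"
  unfolding solution_on_def using absolutely_continuous_imp_continuous_on by blast

lemma solution_on_continuous_component:
  "solution_on \<Omega> \<kappa> X a b x \<Longrightarrow> continuous_on {a..b} (\<lambda>t. x t $ i)"
  using solution_on_continuous by (intro continuous_intros) blast

lemma solution_growth_bound:
  assumes "solution_on \<Omega> \<kappa> X a b x" "a \<le> b" "absolutely_continuous_on_interval a b h"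
    and "\<And>t. \<lbrakk>t \<in> {a<..<b}; (x has_vector_derivative protocol \<Omega> \<kappa> (X t) (x t)) (at t)\<rbrakk>
      \<Longrightarrow> grows_at_most_at c h t"
  shows "h b - h a \<le> c * (b - a)"
proof -
  from assms(1) obtain N where "negligible N"
    "\<forall>t\<in>{a<..<b} - N. (x has_vector_derivative protocol \<Omega> \<kappa> (X t) (x t)) (at t)"
    unfolding solution_on_def by blast
  then show ?thesis using assms(4) by (intro absolutely_continuous_growth_bound[OF assms(2,3)]) auto
qed

lemma solution_on_component_derivative:
  assumes "(x has_vector_derivative y) (at t)"
  shows "((\<lambda>t. x t $ i) has_real_derivative y $ i) (at t)"
  using bounded_linear.has_vector_derivative[OF bounded_linear_vec_nth assms]
  by (simp add: has_real_derivative_iff_has_vector_derivative)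

lemma absolutely_continuous_component:
  assumes "solution_on \<Omega> \<kappa> X a b x"
  shows "absolutely_continuous_on_interval a b (\<lambda>t. x t $ i)"
proof (rule absolutely_continuous_compose[where L = 1 and h = "\<lambda>v. v $ i"])
  show "absolutely_continuous_on_interval a b x" using assms by (simp add: solution_on_def)
  show "norm (x t $ i - x s $ i) \<le> 1 * norm (x t - x s)" for s t
    using component_le_norm_cart[of "x t - x s" i] by simp
qed

lemma protocol_nonpos:
  assumes "\<forall>i. \<kappa> $ i > 0" "\<forall>z>0. \<Omega> z > 0" "consensus_error G x i \<le> 0"
  shows "protocol \<Omega> \<kappa> G x $ i \<le> 0"
proof (cases "consensus_error G x i = 0")
  case False
  then have "\<Omega> \<bar>consensus_error G x i\<bar> > 0" "consensus_error G x i < 0" using assms by auto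
  then show ?thesis using assms(1)[THEN spec[of _ i]] by (simp add: protocol_def mult_le_0_iff divide_le_0_iff)
qed (simp add: protocol_def)

text \<open>
  At a point where the solution is differentiable, the agents attaining the maximum have nonpositive
  velocity, while the others stay below the maximum for some time. To the right of the point all
  agents enter the estimate, to the left only one that attains the maximum.
\<close>

lemma top_value_nonincreasing:
  assumes x: "solution_on \<Omega> \<kappa> X a b x" and ab: "a \<le> b"
    and G: "\<forall>t\<in>{a<..<b}. weighted_graph (X t)"
    and \<kappa>: "\<forall>i. \<kappa> $ i > 0" and \<Omega>: "\<forall>z>0. \<Omega> z > 0"
  shows "top_value (x b) \<le> top_value (x a)"
proof -
  have ac: "absolutely_continuous_on_interval a b (\<lambda>t. top_value (x t))"
  proof (rule absolutely_continuous_compose[where L = 1 and h = top_value])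
    show "absolutely_continuous_on_interval a b x" using x by (simp add: solution_on_def)
  qed (simp add: top_value_lipschitz)
  have "grows_at_most_at 0 (\<lambda>t. top_value (x t)) t"
    if t: "t \<in> {a<..<b}" and der: "(x has_vector_derivative protocol \<Omega> \<kappa> (X t) (x t)) (at t)" for t
    unfolding grows_at_most_at_def
  proof (intro allI impI)
    fix \<epsilon> :: real assume \<epsilon>: "\<epsilon> > 0"
    have topi: "grows_at_most_at 0 (\<lambda>t. x t $ i) t" if i: "x t $ i = top_value (x t)" for i
    proof (rule grows_at_most_at_deriv[OF solution_on_component_derivative[OF der]])
      have "consensus_error (X t) (x t) i \<le> total_weight (X t) * 0"
        by (rule consensus_error_bound[OF G[THEN bspec, OF t]]) (simp_all add: i le_top_value)
      then show "protocol \<Omega> \<kappa> (X t) (x t) $ i \<le> 0" by (intro protocol_nonpos[OF \<kappa> \<Omega>]) simp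
    qed
    have "\<exists>d>0. \<forall>v. t \<le> v \<and> v < t + d \<longrightarrow> x v $ i \<le> top_value (x t) + \<epsilon> * (v - t)" for i
    proof (cases "x t $ i = top_value (x t)")
      case True
      from topi[OF this, unfolded grows_at_most_at_def, THEN spec, THEN mp, OF \<epsilon>]
      obtain d where d: "d > 0" "\<forall>u v. t - d < u \<and> u \<le> t \<and> t \<le> v \<and> v < t + d \<longrightarrow> x v $ i - x u $ i \<le> (0 + \<epsilon>) * (v - u)"
        by blast
      have "x v $ i \<le> top_value (x t) + \<epsilon> * (v - t)" if "t \<le> v \<and> v < t + d" for v
        using d(2)[THEN spec[of _ t], THEN spec[of _ v]] that d(1) True by simp
      then show ?thesis using d(1) by blast
    next
      case False
      then have lt: "x t $ i < top_value (x t)" using le_top_value[of "x t" i] by simp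
      have "isCont (\<lambda>t. x t $ i) t"
        using DERIV_isCont[OF solution_on_component_derivative[OF der]] .
      then have "eventually (\<lambda>v. x v $ i < top_value (x t)) (at t)"
        using lt unfolding isCont_def by (rule order_tendstoD(2))
      then obtain d where d: "d > 0" "\<And>v. v \<noteq> t \<Longrightarrow> dist v t < d \<Longrightarrow> x v $ i < top_value (x t)"
        unfolding eventually_at by auto
      have "x v $ i \<le> top_value (x t) + \<epsilon> * (v - t)" if "t \<le> v \<and> v < t + d" for v
      proof -
        have "x v $ i \<le> top_value (x t)" using d(2)[of v] lt that by (cases "v = t") (auto simp: dist_real_def)
        moreover have "0 \<le> \<epsilon> * (v - t)" using \<epsilon> that by simp
        ultimately show ?thesis by simp
      qed
      then show ?thesis using d(1) by blast
    qed
    then obtain d where d: "\<And>i. d i > 0"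
      "\<And>i v. \<lbrakk>t \<le> v; v < t + d i\<rbrakk> \<Longrightarrow> x v $ i \<le> top_value (x t) + \<epsilon> * (v - t)" by metis
    obtain i where i: "x t $ i = top_value (x t)" using top_value_attained by blast
    from topi[OF i, unfolded grows_at_most_at_def, THEN spec, THEN mp, OF \<epsilon>]
    obtain e where e: "e > 0" "\<forall>u v. t - e < u \<and> u \<le> t \<and> t \<le> v \<and> v < t + e \<longrightarrow> x v $ i - x u $ i \<le> (0 + \<epsilon>) * (v - u)"
      by blast
    define D where "D = min e (Min (range d))"
    have D: "D > 0" "D \<le> e" "\<And>i. D \<le> d i" using d(1) e(1) by (auto simp: D_def min.coboundedI2)
    show "\<exists>d>0. \<forall>u v. t - d < u \<and> u \<le> t \<and> t \<le> v \<and> v < t + d \<longrightarrow>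
        top_value (x v) - top_value (x u) \<le> (0 + \<epsilon>) * (v - u)"
    proof (intro exI[of _ D] conjI D(1) allI impI)
      fix u v assume uv: "t - D < u \<and> u \<le> t \<and> t \<le> v \<and> v < t + D"
      have "top_value (x v) \<le> top_value (x t) + \<epsilon> * (v - t)"
        unfolding top_value_le_iff
      proof
        fix j show "x v $ j \<le> top_value (x t) + \<epsilon> * (v - t)" using d(2)[of v j] D(3)[of j] uv by simp
      qed
      moreover have "top_value (x t) - x u $ i \<le> \<epsilon> * (t - u)"
        using e(2)[THEN spec[of _ u], THEN spec[of _ t]] uv D e(1) i by simp
      moreover have "x u $ i \<le> top_value (x u)" by (rule le_top_value)
      moreover have "\<epsilon> * (v - u) = \<epsilon> * (v - t) + \<epsilon> * (t - u)" by (simp add: algebra_simps)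
      ultimately show "top_value (x v) - top_value (x u) \<le> (0 + \<epsilon>) * (v - u)" by simp
    qed
  qed
  from solution_growth_bound[OF x ab ac this] show ?thesis by simp
qed

lemma spread_nonincreasing:
  assumes x: "solution_on \<Omega> \<kappa> X a b x" and ab: "a \<le> b"
    and G: "\<forall>t\<in>{a<..<b}. weighted_graph (X t)"
    and \<kappa>: "\<forall>i. \<kappa> $ i > 0" and \<Omega>: "\<forall>z>0. \<Omega> z > 0"
  shows "spread (x b) \<le> spread (x a)"
  unfolding spread_def
  using top_value_nonincreasing[OF x ab G \<kappa> \<Omega>] top_value_nonincreasing[OF solution_on_uminus[OF x] ab G \<kappa> \<Omega>]
  by (intro add_mono)

lemma absolutely_continuous_energy:
  assumes x: "solution_on \<Omega> \<kappa> X a b x" and G: "weighted_graph G"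
  shows "absolutely_continuous_on_interval a b (\<lambda>t. energy G (x t))"
proof -
  have "compact (x ` {a..b})" by (intro compact_continuous_image solution_on_continuous[OF x]) simp
  then obtain R where R: "\<And>t. t \<in> {a..b} \<Longrightarrow> norm (x t) \<le> R"
    using compact_imp_bounded bounded_iff by (metis imageI)
  show ?thesis
  proof (rule absolutely_continuous_compose[where L = "2 * total_weight G * R" and h = "energy G"])
    show "absolutely_continuous_on_interval a b x" using x by (simp add: solution_on_def)
    show "norm (energy G (x t) - energy G (x s)) \<le> 2 * total_weight G * R * norm (x t - x s)"
      if "s \<in> {a..b}" "t \<in> {a..b}" for s t
      using energy_lipschitz[OF G R[OF that(2)] R[OF that(1)]] by simp
  qed
qed

text \<open>
  Velocity and error of an agent have the same sign. The energy thus loses the sum of these products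
  per unit of time.
\<close>

lemma dissipation_eq_abs:
  assumes \<kappa>: "\<forall>i. \<kappa> $ i > 0" and \<Omega>: "\<forall>z>0. \<Omega> z > 0"
  shows "protocol \<Omega> \<kappa> G x $ i * consensus_error G x i = \<bar>protocol \<Omega> \<kappa> G x $ i\<bar> * \<bar>consensus_error G x i\<bar>"
proof (cases "consensus_error G x i = 0")
  case False
  then have "0 \<le> \<Omega> \<bar>consensus_error G x i\<bar>" "0 \<le> \<kappa> $ i" using \<kappa> \<Omega> by (simp_all add: less_imp_le)
  then show ?thesis by (simp add: protocol_def abs_mult[symmetric])
qed simp

lemma energy_dissipation:
  assumes \<kappa>: "\<forall>i. \<kappa> $ i > 0" and \<Omega>: "\<forall>z>0. \<Omega> z > 0"
  shows "\<bar>protocol \<Omega> \<kappa> G x $ q\<bar> * \<bar>consensus_error G x q\<bar>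
    \<le> (\<Sum>i\<in>UNIV. protocol \<Omega> \<kappa> G x $ i * consensus_error G x i)"
  unfolding dissipation_eq_abs[OF \<kappa> \<Omega>]
  by (rule member_le_sum) auto

lemma energy_nonincreasing:
  assumes x: "solution_on \<Omega> \<kappa> (\<lambda>_. G) a b x" and ab: "a \<le> b" and G: "weighted_graph G"
    and \<kappa>: "\<forall>i. \<kappa> $ i > 0" and \<Omega>: "\<forall>z>0. \<Omega> z > 0"
  shows "energy G (x b) \<le> energy G (x a)"
proof -
  have "energy G (x b) - energy G (x a) \<le> 0 * (b - a)"
  proof (rule solution_growth_bound[OF x ab absolutely_continuous_energy[OF x G]])
    fix t assume der: "(x has_vector_derivative protocol \<Omega> \<kappa> G (x t)) (at t)"
    show "grows_at_most_at 0 (\<lambda>t. energy G (x t)) t"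
    proof (rule grows_at_most_at_deriv[OF energy_has_derivative[OF G der]])
      show "- (\<Sum>i\<in>UNIV. protocol \<Omega> \<kappa> G (x t) $ i * consensus_error G (x t) i) \<le> 0"
        unfolding dissipation_eq_abs[OF \<kappa> \<Omega>] by (simp add: sum_nonneg)
    qed
  qed
  then show ?thesis by simp
qed

section \<open>Fixed-time descent of the energy while the graph does not change\<close>

text \<open>
  Between the levels \<open>(2 powi (k + 1))\<^sup>2\<close> and \<open>(2 powi k)\<^sup>2\<close> the function descends at least at the
  rate \<open>\<omega> (2 powi k)\<close> belonging to the lower level, and the difference of these levels is
  \<open>3 * (2 powi k)\<^sup>2\<close>. Levels take the place of a change of variables because \<open>\<omega>\<close> may be
  discontinuous.
\<close>

lemma dyadic_descent_time:
  fixes f \<omega> :: "real \<Rightarrow> real" and j J :: int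
  assumes cont: "continuous_on {a..b} f" and ab: "a \<le> b"
    and mono: "\<And>s t. \<lbrakk>a \<le> s; s \<le> t; t \<le> b\<rbrakk> \<Longrightarrow> f t \<le> f s"
    and rate: "\<And>s t y. \<lbrakk>a \<le> s; s \<le> t; t \<le> b; y > 0; \<forall>u\<in>{s..t}. y\<^sup>2 \<le> f u\<rbrakk>
      \<Longrightarrow> f t - f s \<le> - \<omega> y * (t - s)"
    and \<omega>: "\<And>y. y > 0 \<Longrightarrow> \<omega> y > 0"
    and jJ: "j \<le> J" and fb: "(2 powi j)\<^sup>2 < f b" and fa: "f a \<le> (2 powi J)\<^sup>2"
  shows "b - a \<le> (\<Sum>k\<in>{j..<J}. 3 * (2 powi k)\<^sup>2 / \<omega> (2 powi k))"
  using jJ cont ab mono rate fb fa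
proof (induction J arbitrary: a rule: int_ge_induct)
  case base
  then show ?case using base.prems(3)[OF order_refl base.prems(2) order_refl] base.prems(5,6) by linarith
next
  case (step J)
  define p where "p = (2::real) powi J"
  have p: "p > 0" "(2::real) powi (J + 1) = 2 * p" by (simp_all add: p_def power_int_add)
  have "{j..<J + 1} = insert J {j..<J}" using step.hyps by auto
  then have sumeq: "(\<Sum>k\<in>{j..<J + 1}. 3 * (2 powi k)\<^sup>2 / \<omega> (2 powi k)) =
      3 * p\<^sup>2 / \<omega> p + (\<Sum>k\<in>{j..<J}. 3 * (2 powi k)\<^sup>2 / \<omega> (2 powi k))"
    by (simp add: p_def)
  have nonneg: "0 \<le> (\<Sum>k\<in>{j..<J}. 3 * (2 powi k)\<^sup>2 / \<omega> (2 powi k))"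
    by (intro sum_nonneg divide_nonneg_pos \<omega>) auto
  have fa: "f a \<le> 4 * p\<^sup>2" using step.prems(6) p by (simp add: power2_eq_square)
  have slow: "t - a \<le> 3 * p\<^sup>2 / \<omega> p" if t: "a \<le> t" "t \<le> b" and ft: "p\<^sup>2 \<le> f t" for t
  proof -
    have "p\<^sup>2 \<le> f u" if "u \<in> {a..t}" for u using step.prems(3)[of u t] that t ft by simp
    then have "f t - f a \<le> - \<omega> p * (t - a)" using t p by (intro step.prems(4)) auto
    then have "\<omega> p * (t - a) \<le> 3 * p\<^sup>2" using fa ft by simp
    then show ?thesis using \<omega>[OF p(1)] by (simp add: field_simps)
  qed
  show ?case
  proof (cases "p\<^sup>2 \<le> f b")
    case True
    then show ?thesis using slow[of b] step.prems(2) nonneg sumeq by simp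
  next
    case False
    show ?thesis
    proof (cases "f a \<le> p\<^sup>2")
      case True
      then have "b - a \<le> (\<Sum>k\<in>{j..<J}. 3 * (2 powi k)\<^sup>2 / \<omega> (2 powi k))"
        using step.prems by (intro step.IH) (auto simp: p_def)
      moreover have "0 \<le> 3 * p\<^sup>2 / \<omega> p" using \<omega>[OF p(1)] by simp
      ultimately show ?thesis using sumeq by simp
    next
      case fa': False
      have "\<exists>t\<ge>a. t \<le> b \<and> f t = p\<^sup>2"
        using False fa' step.prems(1,2) by (intro IVT2') auto
      then obtain t where t: "a \<le> t" "t \<le> b" "f t = p\<^sup>2" by blast
      have "b - t \<le> (\<Sum>k\<in>{j..<J}. 3 * (2 powi k)\<^sup>2 / \<omega> (2 powi k))"
      proof (rule step.IH)
        show "continuous_on {t..b} f" using t by (intro continuous_on_subset[OF step.prems(1)]) auto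
        show "f t \<le> (2 powi J)\<^sup>2" using t by (simp add: p_def)
        show "f v \<le> f u" if "t \<le> u" "u \<le> v" "v \<le> b" for u v
          using that t by (intro step.prems(3)) auto
        show "f v - f u \<le> - \<omega> y * (v - u)"
          if "t \<le> u" "u \<le> v" "v \<le> b" "0 < y" "\<forall>w\<in>{u..v}. y\<^sup>2 \<le> f w" for u v y
          using that t by (intro step.prems(4)) auto
      qed (use t step.prems in auto)
      then show ?thesis using slow[of t] t sumeq by simp
    qed
  qed
qed

lemma finite_sums_small_tail:
  fixes a :: "'i \<Rightarrow> real"
  assumes bd: "\<And>K. finite K \<Longrightarrow> sum a K \<le> C" and \<delta>: "\<delta> > 0"
  shows "\<exists>K0. finite K0 \<and> (\<forall>K. finite K \<longrightarrow> K \<inter> K0 = {} \<longrightarrow> sum a K < \<delta>)"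
proof -
  define S where "S = {sum a K | K. finite K}"
  have S: "sum a {} \<in> S" "bdd_above S" using bd by (auto simp: S_def bdd_above_def simp del: sum.empty)
  have "Sup S - \<delta> < Sup S" using \<delta> by simp
  then obtain y where "y \<in> S" "Sup S - \<delta> < y" using S by (metis empty_iff less_cSup_iff)
  then obtain K0 where K0: "finite K0" "Sup S - \<delta> < sum a K0" by (auto simp: S_def)
  have "sum a K < \<delta>" if "finite K" "K \<inter> K0 = {}" for K
  proof -
    have "sum a (K \<union> K0) \<le> Sup S" using S(2) that K0(1) by (intro cSup_upper) (auto simp: S_def)
    moreover have "sum a (K \<union> K0) = sum a K + sum a K0" using that K0(1) by (intro sum.union_disjoint) auto
    ultimately show ?thesis using K0(2) by simp
  qed
  then show ?thesis using K0(1) by blast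
qed

text \<open>
  All levels above some \<open>j0\<close> together, and all levels below some \<open>j1\<close> together, take less than time
  \<open>T\<close>. The first fact bounds the energy after time \<open>T\<close> independently of the start; by the second, a
  solution that starts below level \<open>j1\<close> has passed every positive level after time \<open>T\<close>.
\<close>

lemma fixed_graph_descent:
  fixes G :: "('n::finite) wgraph"
  assumes G: "weighted_graph G" and con: "connected_graph G" and \<kappa>: "\<forall>i. \<kappa> $ i > 0"
    and \<Omega>: "dyadically_summable \<Omega> C" and T: "T > 0"
  shows "\<exists>V1>0. \<exists>V2>0. \<forall>a x. solution_on \<Omega> \<kappa> (\<lambda>_. G) a (a + T) x \<longrightarrow>
    energy G (x (a + T)) \<le> V1 \<and> (energy G (x a) \<le> V2 \<longrightarrow> energy G (x (a + T)) = 0)"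
proof -
  have mono: "mono \<Omega>" and pos: "\<forall>z>0. \<Omega> z > 0"
    and bd: "\<And>q K. \<lbrakk>q > 0; finite K\<rbrakk> \<Longrightarrow> (\<Sum>k\<in>K. (q * 2 powi k)\<^sup>2 / \<Omega> (q * 2 powi k)) \<le> C"
    using \<Omega> unfolding dyadically_summable_def by auto
  obtain c where c: "c > 0" "\<And>x. \<exists>q. c * sqrt (energy G x) \<le> \<bar>consensus_error G x q\<bar>"
    using sqrt_energy_le_error[OF G con] by blast
  define m where "m = Min (range (\<lambda>i. \<kappa> $ i))"
  have m: "m > 0" "m \<le> \<kappa> $ i" for i using \<kappa> by (auto simp: m_def)
  (* If the energy is at least y squared, some error is at least c * y, and this agent alone
     dissipates energy at rate m * \<Omega> (c * y). *)
  define \<omega> where "\<omega> y = m * \<Omega> (c * y)" for y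
  have \<omega>: "\<omega> y > 0" if "y > 0" for y using that m pos c(1) by (simp add: \<omega>_def)
  define w where "w k = (c * 2 powi k)\<^sup>2 / \<Omega> (c * 2 powi k)" for k :: int
  define \<delta> where "\<delta> = T * m * c\<^sup>2 / 3"
  have \<delta>: "\<delta> > 0" using T m c by (simp add: \<delta>_def)
  have time: "3 * (2 powi k)\<^sup>2 / \<omega> (2 powi k) = T / \<delta> * w k" for k :: int
    using m T c by (simp add: \<omega>_def w_def \<delta>_def power2_eq_square field_simps)
  obtain K0 where K0: "finite K0" "\<And>K. \<lbrakk>finite K; K \<inter> K0 = {}\<rbrakk> \<Longrightarrow> sum w K < \<delta>"
    using finite_sums_small_tail[where a = w and C = C and \<delta> = \<delta>] bd[OF c(1)] \<delta> unfolding w_def by blast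
  (* A solution that still has to pass levels outside K0 only cannot need time T for them; T < T
     is the resulting contradiction. *)
  have descent: "T < T"
    if x: "solution_on \<Omega> \<kappa> (\<lambda>_. G) a (a + T) x"
      and jJ: "j \<le> J" "(2 powi j)\<^sup>2 < energy G (x (a + T))" "energy G (x a) \<le> (2 powi J)\<^sup>2"
      and disj: "{j..<J} \<inter> K0 = {}" for a x and j J :: int
  proof -
    have "a + T - a \<le> (\<Sum>k\<in>{j..<J}. 3 * (2 powi k)\<^sup>2 / \<omega> (2 powi k))"
    proof (rule dyadic_descent_time[where f = "\<lambda>t. energy G (x t)"])
      show "continuous_on {a..a + T} (\<lambda>t. energy G (x t))"
        by (rule absolutely_continuous_imp_continuous_on[OF absolutely_continuous_energy[OF x G]])
      show "energy G (x t) \<le> energy G (x s)" if "a \<le> s" "s \<le> t" "t \<le> a + T" for s t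
        using energy_nonincreasing[OF solution_on_subinterval[OF x that(1,3)] that(2) G \<kappa> pos] .
      show "energy G (x t) - energy G (x s) \<le> - \<omega> y * (t - s)"
        if st: "a \<le> s" "s \<le> t" "t \<le> a + T" and y: "0 < y" "\<forall>u\<in>{s..t}. y\<^sup>2 \<le> energy G (x u)" for s t y
      proof -
        have x': "solution_on \<Omega> \<kappa> (\<lambda>_. G) s t x" by (rule solution_on_subinterval[OF x st(1,3)])
        show ?thesis
        proof (rule solution_growth_bound[OF x' st(2) absolutely_continuous_energy[OF x' G]])
          fix u assume u: "u \<in> {s<..<t}" and der: "(x has_vector_derivative protocol \<Omega> \<kappa> G (x u)) (at u)"
          show "grows_at_most_at (- \<omega> y) (\<lambda>t. energy G (x t)) u"
          proof (rule grows_at_most_at_deriv[OF energy_has_derivative[OF G der]])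
            obtain q where q: "c * sqrt (energy G (x u)) \<le> \<bar>consensus_error G (x u) q\<bar>" using c(2) by blast
            have "y\<^sup>2 \<le> energy G (x u)" using y(2) u by simp
            then have "y \<le> sqrt (energy G (x u))" by (rule real_le_rsqrt)
            then have "c * y \<le> c * sqrt (energy G (x u))" using c(1) by simp
            with q have e: "c * y \<le> \<bar>consensus_error G (x u) q\<bar>" by simp
            have e0: "\<bar>consensus_error G (x u) q\<bar> > 0"
              using e mult_pos_pos[OF c(1) y(1)] by linarith
            have "\<omega> y \<le> \<kappa> $ q * \<Omega> \<bar>consensus_error G (x u) q\<bar>"
              unfolding \<omega>_def
            proof (intro mult_mono monoD[OF mono] e)
              have "c * y > 0" using c(1) y(1) by simp
              then show "0 \<le> \<Omega> (c * y)" using pos by (simp add: less_imp_le)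
              show "0 \<le> \<kappa> $ q" using \<kappa> by (simp add: less_imp_le)
            qed (rule m)
            also have "\<dots> = protocol \<Omega> \<kappa> G (x u) $ q * consensus_error G (x u) q"
              using e0 by (simp add: protocol_def)
            also have "\<dots> = \<bar>protocol \<Omega> \<kappa> G (x u) $ q\<bar> * \<bar>consensus_error G (x u) q\<bar>"
              by (rule dissipation_eq_abs[OF \<kappa> pos])
            also have "\<dots> \<le> (\<Sum>i\<in>UNIV. protocol \<Omega> \<kappa> G (x u) $ i * consensus_error G (x u) i)"
              by (rule energy_dissipation[OF \<kappa> pos])
            finally show "- (\<Sum>i\<in>UNIV. protocol \<Omega> \<kappa> G (x u) $ i * consensus_error G (x u) i) \<le> - \<omega> y"
              by simp
          qed
        qed
      qed
      show "a \<le> a + T" using T by simp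
    qed (rule \<omega> jJ; assumption?)+
    also have "\<dots> = T / \<delta> * sum w {j..<J}" by (simp add: time sum_distrib_left)
    also have "\<dots> < T / \<delta> * \<delta>" using K0(2)[OF _ disj] T \<delta> by (intro mult_strict_left_mono) auto
    finally show ?thesis using \<delta> by simp
  qed
  define j0 where "j0 = Max (insert 0 K0) + 1"
  define j1 where "j1 = Min (insert 0 K0)"
  have j0: "k < j0" if "k \<in> K0" for k
  proof -
    have "k \<le> Max (insert 0 K0)" using K0(1) that by (intro Max_ge) auto
    then show ?thesis by (simp add: j0_def)
  qed
  have j1: "j1 \<le> k" if "k \<in> K0" for k using K0(1) that by (simp add: j1_def)
  have L: "energy G (x (a + T)) \<le> (2 powi j0)\<^sup>2" if x: "solution_on \<Omega> \<kappa> (\<lambda>_. G) a (a + T) x" for a x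
  proof (rule ccontr)
    assume "\<not> ?thesis"
    then have big: "(2 powi j0)\<^sup>2 < energy G (x (a + T))" by simp
    obtain n where n: "energy G (x a) < 2 ^ n" using real_arch_pow[of 2 "energy G (x a)"] by auto
    define J where "J = max j0 (int n)"
    have "(2::real) ^ n \<le> (2 ^ n)\<^sup>2" by (simp add: power2_eq_square)
    also have "\<dots> = (2 powi (int n))\<^sup>2" by simp
    also have "\<dots> \<le> (2 powi J)\<^sup>2" by (intro power_mono power_int_increasing) (auto simp: J_def)
    finally have "energy G (x a) \<le> (2 powi J)\<^sup>2" using n by simp
    moreover have "{j0..<J} \<inter> K0 = {}" using j0 by fastforce
    ultimately show False using descent[OF x _ big, of J] by (auto simp: J_def)
  qed
  have S: "energy G (x (a + T)) = 0"
    if x: "solution_on \<Omega> \<kappa> (\<lambda>_. G) a (a + T) x" and small: "energy G (x a) \<le> (2 powi j1)\<^sup>2" for a x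
  proof (rule ccontr)
    assume "energy G (x (a + T)) \<noteq> 0"
    then have "energy G (x (a + T)) > 0" using energy_nonneg[OF G, of "x (a + T)"] by simp
    then obtain n where n: "(1 / 2) ^ n < energy G (x (a + T))" using real_arch_pow_inv[of _ "1/2"] by auto
    define j where "j = min j1 (- int n)"
    have p01: "(2::real) powi (- int n) = (1 / 2) ^ n" by (simp add: power_int_minus power_divide field_simps)
    have "((2::real) powi j)\<^sup>2 \<le> (2 powi (- int n))\<^sup>2" by (intro power_mono power_int_increasing) (auto simp: j_def)
    also have "\<dots> \<le> (1 / 2) ^ n" unfolding p01 by (simp add: power2_eq_square mult_left_le power_le_one)
    finally have "(2 powi j)\<^sup>2 < energy G (x (a + T))" using n by simp
    moreover have "{j..<j1} \<inter> K0 = {}" using j1 by fastforce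
    moreover have "j \<le> j1" by (simp add: j_def)
    ultimately show False using descent[OF x _ _ small] by blast
  qed
  show ?thesis
    by (intro exI[of _ "(2 powi j0)\<^sup>2"] exI[of _ "(2 powi j1)\<^sup>2"] conjI allI impI)
      (auto intro: L S)
qed

section \<open>Contraction of the spread while the graph does not change\<close>

lemma first_and_last_time:
  fixes f :: "real \<Rightarrow> real"
  assumes cont: "continuous_on {a..b} f" and ex: "\<exists>t\<in>{a..b}. f t \<le> c"
  obtains s t where "a \<le> s" "s \<le> t" "t \<le> b" "f s \<le> c" "f t \<le> c"
    "\<And>u. a \<le> u \<Longrightarrow> u < s \<Longrightarrow> c < f u" "\<And>u. t < u \<Longrightarrow> u \<le> b \<Longrightarrow> c < f u"
proof -
  define S where "S = {a..b} \<inter> f -` {..c}"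
  have "closed S" unfolding S_def by (intro continuous_closed_preimage cont) auto
  moreover have "bounded S" by (rule bounded_subset[of "{a..b}"]) (auto simp: S_def)
  ultimately have S: "compact S" by (simp add: compact_eq_bounded_closed)
  have ne: "S \<noteq> {}" using ex by (auto simp: S_def)
  obtain s where s: "s \<in> S" "\<forall>u\<in>S. s \<le> u" using compact_attains_inf[OF S ne] by blast
  obtain t where t: "t \<in> S" "\<forall>u\<in>S. u \<le> t" using compact_attains_sup[OF S ne] by blast
  have st: "a \<le> s" "s \<le> b" "f s \<le> c" "a \<le> t" "t \<le> b" "f t \<le> c" using s(1) t(1) by (auto simp: S_def)
  show thesis
  proof (rule that[of s t])
    show "s \<le> t" using s(2) t(1) by blast
    show "c < f u" if "a \<le> u" "u < s" for u
    proof (rule ccontr)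
      assume "\<not> c < f u"
      then have "u \<in> S" using that st by (auto simp: S_def)
      then show False using s(2) that by force
    qed
    show "c < f u" if "t < u" "u \<le> b" for u
    proof (rule ccontr)
      assume "\<not> c < f u"
      then have "u \<in> S" using that st by (auto simp: S_def)
      then show False using t(2) that by force
    qed
  qed (use st in auto)
qed

text \<open>
  The energy loses at least \<open>\<bar>x' i\<bar> * \<bar>e i\<bar>\<close> per unit of time. Hence the energy plus \<open>\<epsilon>\<close> times
  \<open>x i\<close>, and likewise the energy minus \<open>\<epsilon>\<close> times \<open>x i\<close>, is nonincreasing while \<open>\<bar>e i\<bar> \<ge> \<epsilon>\<close>.
\<close>

lemma movement_cost:
  assumes x: "solution_on \<Omega> \<kappa> (\<lambda>_. G) a b x" and ab: "a \<le> b" and G: "weighted_graph G"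
    and \<kappa>: "\<forall>i. \<kappa> $ i > 0" and \<Omega>: "\<forall>z>0. \<Omega> z > 0" and \<epsilon>: "\<epsilon> > 0"
    and big: "\<And>t. \<lbrakk>a < t; t < b\<rbrakk> \<Longrightarrow> \<epsilon> \<le> \<bar>consensus_error G (x t) i\<bar>"
  shows "\<epsilon> * \<bar>x b $ i - x a $ i\<bar> \<le> energy G (x a) - energy G (x b)"
proof -
  have le: "\<epsilon> * (\<theta> * (x b $ i - x a $ i)) \<le> energy G (x a) - energy G (x b)" if \<theta>: "\<bar>\<theta>\<bar> = 1" for \<theta> :: real
  proof -
    define h where "h = (\<lambda>v. energy G v + \<epsilon> * \<theta> * v $ i)"
    have "compact (x ` {a..b})" by (intro compact_continuous_image solution_on_continuous[OF x]) simp
    then obtain R where R: "\<And>t. t \<in> {a..b} \<Longrightarrow> norm (x t) \<le> R"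
      using compact_imp_bounded bounded_iff by (metis imageI)
    have ac: "absolutely_continuous_on_interval a b (\<lambda>t. h (x t))"
    proof (rule absolutely_continuous_compose[where L = "2 * total_weight G * R + \<epsilon>" and h = h])
      show "absolutely_continuous_on_interval a b x" using x by (simp add: solution_on_def)
      show "norm (h (x t) - h (x s)) \<le> (2 * total_weight G * R + \<epsilon>) * norm (x t - x s)"
        if "s \<in> {a..b}" "t \<in> {a..b}" for s t
      proof -
        have 1: "\<bar>energy G (x t) - energy G (x s)\<bar> \<le> 2 * total_weight G * R * norm (x t - x s)"
          by (rule energy_lipschitz[OF G R[OF that(2)] R[OF that(1)]])
        have "\<bar>\<epsilon> * \<theta> * x t $ i - \<epsilon> * \<theta> * x s $ i\<bar> = \<epsilon> * \<bar>x t $ i - x s $ i\<bar>"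
          using \<epsilon> \<theta> by (simp add: abs_mult flip: right_diff_distrib)
        also have "\<dots> \<le> \<epsilon> * norm (x t - x s)"
          using component_le_norm_cart[of "x t - x s" i] \<epsilon> by (intro mult_left_mono) auto
        finally have 2: "\<bar>\<epsilon> * \<theta> * x t $ i - \<epsilon> * \<theta> * x s $ i\<bar> \<le> \<epsilon> * norm (x t - x s)" .
        have "norm (h (x t) - h (x s)) \<le> \<bar>energy G (x t) - energy G (x s)\<bar> + \<bar>\<epsilon> * \<theta> * x t $ i - \<epsilon> * \<theta> * x s $ i\<bar>"
          unfolding h_def real_norm_def by linarith
        with 1 2 show ?thesis unfolding distrib_right by linarith
      qed
    qed
    have "h (x b) - h (x a) \<le> 0 * (b - a)"
    proof (rule solution_growth_bound[OF x ab ac])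
      fix t assume t: "t \<in> {a<..<b}" and der: "(x has_vector_derivative protocol \<Omega> \<kappa> G (x t)) (at t)"
      define y where "y = protocol \<Omega> \<kappa> G (x t)"
      have "((\<lambda>t. h (x t)) has_real_derivative
          - (\<Sum>i\<in>UNIV. y $ i * consensus_error G (x t) i) + \<epsilon> * \<theta> * y $ i) (at t)"
        unfolding h_def y_def
        by (intro DERIV_add DERIV_cmult energy_has_derivative[OF G der] solution_on_component_derivative[OF der])
      then show "grows_at_most_at 0 (\<lambda>t. h (x t)) t"
      proof (rule grows_at_most_at_deriv)
        have "\<epsilon> * \<theta> * y $ i \<le> \<bar>\<epsilon> * \<theta> * y $ i\<bar>" by simp
        also have "\<dots> = \<bar>y $ i\<bar> * \<epsilon>" using \<epsilon> \<theta> by (simp add: abs_mult)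
        also have "\<dots> \<le> \<bar>y $ i\<bar> * \<bar>consensus_error G (x t) i\<bar>" using big[of t] t by (intro mult_left_mono) auto
        also have "\<dots> \<le> (\<Sum>i\<in>UNIV. y $ i * consensus_error G (x t) i)"
          unfolding y_def by (rule energy_dissipation[OF \<kappa> \<Omega>])
        finally show "- (\<Sum>i\<in>UNIV. y $ i * consensus_error G (x t) i) + \<epsilon> * \<theta> * y $ i \<le> 0" by simp
      qed
    qed
    then have "\<epsilon> * \<theta> * x b $ i - \<epsilon> * \<theta> * x a $ i \<le> energy G (x a) - energy G (x b)" by (simp add: h_def)
    then show ?thesis by (simp add: algebra_simps)
  qed
  from le[of 1] le[of "-1"] show ?thesis by (cases "0 \<le> x b $ i - x a $ i") (simp_all add: abs_if)
qed

text \<open>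
  A discrete maximum principle: if a component is almost maximal and the error there is not very
  negative, then the values at the neighbours are almost maximal as well.
\<close>

lemma neighbour_displacement:
  assumes G: "weighted_graph G" and jk: "{j, k} \<in> edges G"
    and R: "\<And>l. z $ l \<le> R" and zj: "R - \<gamma> \<le> z $ j" and \<gamma>: "0 \<le> \<gamma>"
    and e: "- \<eta> \<le> consensus_error G z j"
  shows "R - (\<eta> + total_weight G * \<gamma>) / adj G j k \<le> z $ k"
proof -
  have A: "adj G j k > 0" by (rule adj_pos[OF G jk])
  have nn: "0 \<le> adj G j l * (z $ j - z $ l + \<gamma>)" for l
    using R[of l] zj by (intro mult_nonneg_nonneg adj_nonneg G) simp
  have "adj G j k * (z $ j - z $ k + \<gamma>) \<le> (\<Sum>l\<in>UNIV. adj G j l * (z $ j - z $ l + \<gamma>))"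
    by (rule member_le_sum) (auto intro: nn)
  also have "\<dots> = - consensus_error G z j + (\<Sum>l\<in>UNIV. adj G j l) * \<gamma>"
  proof -
    have "adj G j l * (z $ j - z $ l + \<gamma>) = - (adj G j l * (z $ l - z $ j)) + adj G j l * \<gamma>" for l
      by (simp add: algebra_simps)
    then show ?thesis by (simp only: consensus_error_adj sum_distrib_right sum_negf sum.distrib)
  qed
  also have "\<dots> \<le> \<eta> + total_weight G * \<gamma>"
    using e degree_le_total_weight[OF G, of j] \<gamma> by (intro add_mono mult_right_mono) auto
  finally have "z $ j - z $ k + \<gamma> \<le> (\<eta> + total_weight G * \<gamma>) / adj G j k"
    using A by (simp add: field_simps)
  then show ?thesis using zj by simp
qed

text \<open>
  The displacement is measured between arbitrary times of the window, not only from its left end.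
  This symmetric form makes the maximum principle applicable to differences of two states.
\<close>

definition displaced :: "real \<Rightarrow> real \<Rightarrow> (real \<Rightarrow> real ^ 'n) \<Rightarrow> real \<Rightarrow> 'n \<Rightarrow> bool" where
  "displaced a b x r i \<longleftrightarrow> (\<exists>s\<in>{a..b}. \<exists>t\<in>{a..b}. r \<le> \<bar>x t $ i - x s $ i\<bar>)"

text \<open>
  A window that costs energy at most \<open>\<epsilon> * \<mu>\<close>, so that an agent whose error stays above \<open>\<epsilon>\<close> moves at
  most by \<open>\<mu>\<close>. The number \<open>R\<close> bounds all displacements within the window.
\<close>

definition cheap_window ::
  "(real \<Rightarrow> real) \<Rightarrow> real ^ 'n \<Rightarrow> ('n::finite) wgraph \<Rightarrow> real \<Rightarrow> real \<Rightarrow> (real \<Rightarrow> real ^ 'n) \<Rightarrow> real \<Rightarrow> real \<Rightarrow> real \<Rightarrow> bool" where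
  "cheap_window \<Omega> \<kappa> G a b x \<epsilon> \<mu> R \<longleftrightarrow> solution_on \<Omega> \<kappa> (\<lambda>_. G) a b x \<and> 0 < \<epsilon> \<and> 0 \<le> \<mu> \<and>
     energy G (x a) - energy G (x b) \<le> \<epsilon> * \<mu> \<and>
     (\<forall>i. \<forall>s\<in>{a..b}. \<forall>t\<in>{a..b}. \<bar>x t $ i - x s $ i\<bar> \<le> R)"

lemma cheap_window_quiet:
  assumes win: "cheap_window \<Omega> \<kappa> G a b x \<epsilon> \<mu> R" and G: "weighted_graph G"
    and \<kappa>: "\<forall>i. \<kappa> $ i > 0" and \<Omega>: "\<forall>z>0. \<Omega> z > 0"
    and uv: "a \<le> u" "u \<le> v" "v \<le> b" and big: "\<And>w. \<lbrakk>u < w; w < v\<rbrakk> \<Longrightarrow> \<epsilon> \<le> \<bar>consensus_error G (x w) j\<bar>"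
  shows "\<bar>x v $ j - x u $ j\<bar> \<le> \<mu>"
proof -
  have x: "solution_on \<Omega> \<kappa> (\<lambda>_. G) a b x" and \<epsilon>: "\<epsilon> > 0"
    and drop: "energy G (x a) - energy G (x b) \<le> \<epsilon> * \<mu>" using win by (simp_all add: cheap_window_def)
  have "\<epsilon> * \<bar>x v $ j - x u $ j\<bar> \<le> energy G (x u) - energy G (x v)"
    by (rule movement_cost[OF solution_on_subinterval[OF x uv(1,3)] uv(2) G \<kappa> \<Omega> \<epsilon> big])
  also have "\<dots> \<le> energy G (x a) - energy G (x b)"
    using energy_nonincreasing[OF solution_on_subinterval[OF x order_refl, of u] uv(1) G \<kappa> \<Omega>]
      energy_nonincreasing[OF solution_on_subinterval[OF x _ order_refl, of v] uv(3) G \<kappa> \<Omega>] uv by simp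
  also have "\<dots> \<le> \<epsilon> * \<mu>" by (rule drop)
  finally show ?thesis using \<epsilon> by simp
qed

text \<open>
  If agent \<open>j\<close> is displaced almost as far as possible, consider the first and the last time at which
  its error is at most \<open>\<epsilon>\<close>. Before and after these times it moves by at most \<open>\<mu>\<close>, so nearly all of
  the displacement happens between them; the difference of the two states has a small error at \<open>j\<close>,
  and the maximum principle carries the displacement over to the neighbour \<open>k\<close>.
\<close>

lemma displacement_spreads:
  fixes G :: "('n::finite) wgraph"
  assumes win: "cheap_window \<Omega> \<kappa> G a b x \<epsilon> \<mu> R"
    and G: "weighted_graph G" and jk: "{j, k} \<in> edges G"
    and \<kappa>: "\<forall>i. \<kappa> $ i > 0" and \<Omega>: "\<forall>z>0. \<Omega> z > 0"
    and j: "displaced a b x (R - \<delta>) j" and \<delta>: "0 \<le> \<delta>"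
  shows "R \<le> \<delta> + \<mu> \<or>
    displaced a b x (R - (2 * \<epsilon> + total_weight G * (\<delta> + 2 * \<mu>)) / adj G j k) k"
proof -
  have x: "solution_on \<Omega> \<kappa> (\<lambda>_. G) a b x" and \<epsilon>: "\<epsilon> > 0" and \<mu>: "0 \<le> \<mu>"
    and R: "\<And>i s t. \<lbrakk>s \<in> {a..b}; t \<in> {a..b}\<rbrakk> \<Longrightarrow> \<bar>x t $ i - x s $ i\<bar> \<le> R"
    using win by (simp_all add: cheap_window_def)
  note quiet = cheap_window_quiet[OF win G \<kappa> \<Omega>]
  have main: "R \<le> \<delta> + \<mu> \<or> displaced a b x (R - (2 * \<epsilon> + total_weight G * (\<delta> + 2 * \<mu>)) / adj G j k) k"
    if st: "a \<le> s" "s \<le> t" "t \<le> b" and Rj: "R - \<delta> \<le> \<bar>x t $ j - x s $ j\<bar>" for s t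
  proof (cases "\<exists>u\<in>{s..t}. \<bar>consensus_error G (x u) j\<bar> \<le> \<epsilon>")
    case False
    then have "\<epsilon> \<le> \<bar>consensus_error G (x w) j\<bar>" if "s < w" "w < t" for w
      using that by (metis atLeastAtMost_iff less_imp_le nle_le)
    then have "\<bar>x t $ j - x s $ j\<bar> \<le> \<mu>" by (intro quiet st)
    then show ?thesis using Rj by simp
  next
    case True
    have "continuous_on {s..t} (\<lambda>u. \<bar>consensus_error G (x u) j\<bar>)"
      using st by (intro continuous_intros continuous_on_consensus_error
          continuous_on_subset[OF solution_on_continuous[OF x]]) auto
    from first_and_last_time[OF this True]
    obtain s' t' where s't': "s \<le> s'" "s' \<le> t'" "t' \<le> t"
      and e: "\<bar>consensus_error G (x s') j\<bar> \<le> \<epsilon>" "\<bar>consensus_error G (x t') j\<bar> \<le> \<epsilon>"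
      and before: "\<And>u. s \<le> u \<Longrightarrow> u < s' \<Longrightarrow> \<epsilon> < \<bar>consensus_error G (x u) j\<bar>"
      and after: "\<And>u. t' < u \<Longrightarrow> u \<le> t \<Longrightarrow> \<epsilon> < \<bar>consensus_error G (x u) j\<bar>"
      by blast
    have "\<bar>x s' $ j - x s $ j\<bar> \<le> \<mu>"
    proof (rule quiet[OF st(1) s't'(1)])
      show "s' \<le> b" using st s't' by simp
    qed (use before in \<open>simp add: less_imp_le\<close>)
    moreover have "\<bar>x t $ j - x t' $ j\<bar> \<le> \<mu>"
    proof (rule quiet[OF _ s't'(3) st(3)])
      show "a \<le> t'" using st s't' by simp
    qed (use after in \<open>simp add: less_imp_le\<close>)
    ultimately have zj: "R - (\<delta> + 2 * \<mu>) \<le> \<bar>(x t' - x s') $ j\<bar>" using Rj by simp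
    have in': "s' \<in> {a..b}" "t' \<in> {a..b}" using st s't' by auto
    have \<gamma>: "0 \<le> \<delta> + 2 * \<mu>" using \<delta> \<mu> by simp
    have "R - (2 * \<epsilon> + total_weight G * (\<delta> + 2 * \<mu>)) / adj G j k \<le> \<bar>x t' $ k - x s' $ k\<bar>"
    proof (cases "0 \<le> (x t' - x s') $ j")
      case True
      have "R - (2 * \<epsilon> + total_weight G * (\<delta> + 2 * \<mu>)) / adj G j k \<le> (x t' - x s') $ k"
      proof (rule neighbour_displacement[OF G jk _ _ \<gamma>])
        show "(x t' - x s') $ l \<le> R" for l using R[OF in', of l] by simp
        show "R - (\<delta> + 2 * \<mu>) \<le> (x t' - x s') $ j" using zj True by simp
        show "- (2 * \<epsilon>) \<le> consensus_error G (x t' - x s') j" using e by (simp add: consensus_error_diff)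
      qed
      then show ?thesis by simp
    next
      case False
      have "R - (2 * \<epsilon> + total_weight G * (\<delta> + 2 * \<mu>)) / adj G j k \<le> (x s' - x t') $ k"
      proof (rule neighbour_displacement[OF G jk _ _ \<gamma>])
        show "(x s' - x t') $ l \<le> R" for l using R[OF in', of l] by simp
        show "R - (\<delta> + 2 * \<mu>) \<le> (x s' - x t') $ j" using zj False by simp
        show "- (2 * \<epsilon>) \<le> consensus_error G (x s' - x t') j" using e by (simp add: consensus_error_diff)
      qed
      then show ?thesis by simp
    qed
    then show ?thesis using in' unfolding displaced_def by blast
  qed
  obtain s t where st: "s \<in> {a..b}" "t \<in> {a..b}" "R - \<delta> \<le> \<bar>x t $ j - x s $ j\<bar>"
    using j unfolding displaced_def by blast
  show ?thesis
  proof (cases "s \<le> t")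
    case True
    then show ?thesis using main[of s t] st by simp
  next
    case False
    then show ?thesis using main[of t s] st by (simp add: abs_minus_commute)
  qed
qed

text \<open>
  The largest displacement propagates along a path from \<open>i\<close> to the agent \<open>q\<close>, losing a multiple of
  \<open>\<epsilon> + \<mu>\<close> at each step. But \<open>q\<close>, whose error is never small, moves at most by \<open>\<mu>\<close>.
\<close>

lemma displacement_bound:
  fixes G :: "('n::finite) wgraph"
  assumes G: "weighted_graph G" and con: "connected_graph G" and \<kappa>: "\<forall>i. \<kappa> $ i > 0" and \<Omega>: "\<forall>z>0. \<Omega> z > 0"
  shows "\<exists>K>0. \<forall>a b x \<epsilon> \<mu> R q i. cheap_window \<Omega> \<kappa> G a b x \<epsilon> \<mu> R \<longrightarrow>
    (\<forall>u\<in>{a..b}. \<epsilon> \<le> \<bar>consensus_error G (x u) q\<bar>) \<longrightarrow> displaced a b x R i \<longrightarrow> R \<le> K * (\<epsilon> + \<mu>)"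
proof -
  define W where "W = total_weight G"
  have W: "W \<ge> 0" using total_weight_nonneg[OF G] by (simp add: W_def)
  define Q where "Q i q K \<longleftrightarrow> (\<forall>a b x \<epsilon> \<mu> R. cheap_window \<Omega> \<kappa> G a b x \<epsilon> \<mu> R \<longrightarrow> displaced a b x R i \<longrightarrow>
    R \<le> K * (\<epsilon> + \<mu>) \<or> displaced a b x (R - K * (\<epsilon> + \<mu>)) q)" for i q K
  have "\<exists>K\<ge>0. Q i q K" for i q
  proof -
    have "(i, q) \<in> {(u, v). {u, v} \<in> edges G}\<^sup>*" using con by (simp add: connected_graph_def)
    then show ?thesis
    proof (induction rule: rtrancl_induct)
      case base
      show ?case by (intro exI[of _ 0]) (simp add: Q_def)
    next
      case (step j k)
      then obtain K where K0: "K \<ge> 0" and K: "Q i j K" by blast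
      have jk: "{j, k} \<in> edges G" using step.hyps by simp
      have A: "adj G j k > 0" by (rule adj_pos[OF G jk])
      define B where "B = (2 + W * (K + 2)) / adj G j k"
      have B: "B \<ge> 0" using A W K0 by (simp add: B_def)
      define K' where "K' = K + 1 + B"
      have "Q i k K'"
        unfolding Q_def
      proof (intro allI impI)
        fix a b \<epsilon> \<mu> R :: real and x
        assume win: "cheap_window \<Omega> \<kappa> G a b x \<epsilon> \<mu> R" and i: "displaced a b x R i"
        have \<epsilon>: "0 < \<epsilon>" and \<mu>: "0 \<le> \<mu>" using win by (simp_all add: cheap_window_def)
        have nn: "0 \<le> \<epsilon> + \<mu>" using \<epsilon> \<mu> by simp
        have KK': "K * (\<epsilon> + \<mu>) + \<mu> \<le> K' * (\<epsilon> + \<mu>)"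
        proof -
          have "0 \<le> B * (\<epsilon> + \<mu>)" using B nn by simp
          then show ?thesis using \<epsilon> by (simp add: K'_def algebra_simps)
        qed
        have "2 * \<epsilon> + W * (K * (\<epsilon> + \<mu>) + 2 * \<mu>) \<le> (2 + W * (K + 2)) * (\<epsilon> + \<mu>)"
        proof -
          have "0 \<le> W * \<epsilon>" using W \<epsilon> by simp
          then show ?thesis using \<mu> by (simp add: algebra_simps)
        qed
        then have "(2 * \<epsilon> + W * (K * (\<epsilon> + \<mu>) + 2 * \<mu>)) / adj G j k \<le> B * (\<epsilon> + \<mu>)"
          unfolding B_def times_divide_eq_left using A by (intro divide_right_mono) auto
        also have "\<dots> \<le> K' * (\<epsilon> + \<mu>)" using nn K0 by (intro mult_right_mono) (auto simp: K'_def)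
        finally have le: "(2 * \<epsilon> + W * (K * (\<epsilon> + \<mu>) + 2 * \<mu>)) / adj G j k \<le> K' * (\<epsilon> + \<mu>)" .
        from K[unfolded Q_def, THEN spec, THEN spec, THEN spec, THEN spec, THEN spec, THEN spec, THEN mp, THEN mp, OF win i]
        show "R \<le> K' * (\<epsilon> + \<mu>) \<or> displaced a b x (R - K' * (\<epsilon> + \<mu>)) k"
        proof
          assume "R \<le> K * (\<epsilon> + \<mu>)"
          then show ?thesis using KK' \<mu> by simp
        next
          assume j: "displaced a b x (R - K * (\<epsilon> + \<mu>)) j"
          have "0 \<le> K * (\<epsilon> + \<mu>)" using K0 nn by simp
          from displacement_spreads[OF win G jk \<kappa> \<Omega> j this]
          show ?thesis
          proof
            assume "R \<le> K * (\<epsilon> + \<mu>) + \<mu>"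
            then show ?thesis using KK' by simp
          next
            assume "displaced a b x (R - (2 * \<epsilon> + total_weight G * (K * (\<epsilon> + \<mu>) + 2 * \<mu>)) / adj G j k) k"
            then obtain s t where "s \<in> {a..b}" "t \<in> {a..b}"
              and "R - (2 * \<epsilon> + W * (K * (\<epsilon> + \<mu>) + 2 * \<mu>)) / adj G j k \<le> \<bar>x t $ k - x s $ k\<bar>"
              unfolding displaced_def W_def by blast
            moreover from this(3) have "R - K' * (\<epsilon> + \<mu>) \<le> \<bar>x t $ k - x s $ k\<bar>" using le by linarith
            ultimately show ?thesis unfolding displaced_def by blast
          qed
        qed
      qed
      moreover have "0 \<le> K'" using K0 B by (simp add: K'_def)
      ultimately show ?case by blast
    qed
  qed
  then obtain K where K0: "\<And>i q. K i q \<ge> 0" and K: "\<And>i q. Q i q (K i q)" by metis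
  define L where "L = (\<Sum>i\<in>UNIV. \<Sum>q\<in>UNIV. K i q) + 1"
  have KL: "K i q + 1 \<le> L" for i q
  proof -
    have "K i q \<le> (\<Sum>q\<in>UNIV. K i q)" by (rule member_le_sum) (auto intro: K0)
    also have "\<dots> \<le> (\<Sum>i\<in>UNIV. \<Sum>q\<in>UNIV. K i q)"
      by (rule member_le_sum) (auto intro!: sum_nonneg K0)
    finally show ?thesis by (simp add: L_def)
  qed
  show ?thesis
  proof (intro exI[of _ L] conjI allI impI)
    show "0 < L" using KL[of undefined undefined] K0[of undefined undefined] by linarith
    fix a b \<epsilon> \<mu> R :: real and x and q i :: 'n
    assume win: "cheap_window \<Omega> \<kappa> G a b x \<epsilon> \<mu> R"
      and q: "\<forall>u\<in>{a..b}. \<epsilon> \<le> \<bar>consensus_error G (x u) q\<bar>" and i: "displaced a b x R i"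
    have \<epsilon>: "0 < \<epsilon>" and \<mu>: "0 \<le> \<mu>" using win by (simp_all add: cheap_window_def)
    have quiet: "\<bar>x v $ q - x u $ q\<bar> \<le> \<mu>" if "u \<in> {a..b}" "v \<in> {a..b}" "u \<le> v" for u v
      using that q by (intro cheap_window_quiet[OF win G \<kappa> \<Omega>]) auto
    have quiet': "\<bar>x v $ q - x u $ q\<bar> \<le> \<mu>" if "u \<in> {a..b}" "v \<in> {a..b}" for u v
      using quiet[of u v] quiet[of v u] that by (cases "u \<le> v") (simp_all add: abs_minus_commute)
    from K[of i q, unfolded Q_def, THEN spec, THEN spec, THEN spec, THEN spec, THEN spec, THEN spec, THEN mp, THEN mp, OF win i]
    have "R \<le> K i q * (\<epsilon> + \<mu>) + \<mu>"
    proof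
      assume "R \<le> K i q * (\<epsilon> + \<mu>)" then show ?thesis using \<mu> by simp
    next
      assume "displaced a b x (R - K i q * (\<epsilon> + \<mu>)) q"
      then obtain s t where "s \<in> {a..b}" "t \<in> {a..b}" "R - K i q * (\<epsilon> + \<mu>) \<le> \<bar>x t $ q - x s $ q\<bar>"
        unfolding displaced_def by blast
      then show ?thesis using quiet'[of s t] by simp
    qed
    also have "\<dots> \<le> (K i q + 1) * (\<epsilon> + \<mu>)" using \<epsilon> by (simp add: algebra_simps)
    also have "\<dots> \<le> L * (\<epsilon> + \<mu>)" using \<epsilon> \<mu> KL[of i q] by (intro mult_right_mono) auto
    finally show "R \<le> L * (\<epsilon> + \<mu>)" .
  qed
qed

text \<open>
  If the spread is \<open>D\<close>, some error at the start of the window is at least a multiple of \<open>D\<close>, and it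
  stays large until the state has moved by a certain fraction of \<open>D\<close>. Up to the first time this
  happens \<open>displacement_bound\<close> applies, and for a sufficiently cheap window it shows that the state
  has moved less than this.
\<close>

lemma cheap_window_stationary:
  fixes G :: "('n::finite) wgraph"
  assumes G: "weighted_graph G" and con: "connected_graph G" and \<kappa>: "\<forall>i. \<kappa> $ i > 0" and \<Omega>: "\<forall>z>0. \<Omega> z > 0"
    and \<rho>: "\<rho> > 0"
  shows "\<exists>c>0. \<forall>a b x t i. solution_on \<Omega> \<kappa> (\<lambda>_. G) a b x \<longrightarrow> 0 < spread (x a) \<longrightarrow>
    energy G (x a) - energy G (x b) \<le> c * (spread (x a))\<^sup>2 \<longrightarrow> t \<in> {a..b} \<longrightarrow>
    \<bar>x t $ i - x a $ i\<bar> \<le> \<rho> * spread (x a)"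
proof -
  define W where "W = total_weight G"
  have W: "W \<ge> 0" using total_weight_nonneg[OF G] by (simp add: W_def)
  obtain K where K: "K > 0" "\<And>a b x \<epsilon> \<mu> R q i. \<lbrakk>cheap_window \<Omega> \<kappa> G a b x \<epsilon> \<mu> R;
    \<forall>u\<in>{a..b}. \<epsilon> \<le> \<bar>consensus_error G (x u) q\<bar>; displaced a b x R i\<rbrakk> \<Longrightarrow> R \<le> K * (\<epsilon> + \<mu>)"
    using displacement_bound[OF G con \<kappa> \<Omega>] by meson
  obtain e where e: "e > 0" "\<And>x. \<exists>q. e * spread x \<le> \<bar>consensus_error G x q\<bar>"
    using spread_le_error[OF G con] by blast
  (* Displacements up to r * D change an error by at most 2 * W * r * D, hence leave at least half of
     an error of size e * D. The next two constants make K * (\<epsilon> + \<mu>) smaller than r. *)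
  define r where "r = min \<rho> (e / (4 * (W + 1)))"
  have r: "r > 0" "r \<le> \<rho>" using \<rho> e W by (simp_all add: r_def)
  have Wr: "2 * W * r \<le> e / 2"
  proof -
    have "2 * W * r \<le> 2 * (W + 1) * (e / (4 * (W + 1)))"
      using W r by (intro mult_mono) (auto simp: r_def)
    also have "\<dots> = e / 2" using W by (simp add: divide_simps)
    finally show ?thesis .
  qed
  define \<epsilon> where "\<epsilon> = min (e / 2) (r / (4 * K))"
  define \<mu> where "\<mu> = r / (4 * K)"
  have \<epsilon>: "\<epsilon> > 0" "\<epsilon> \<le> e / 2" and \<mu>: "\<mu> > 0" using e r K by (simp_all add: \<epsilon>_def \<mu>_def)
  have Kr: "K * (\<epsilon> + \<mu>) < r"
  proof -
    have "K * (\<epsilon> + \<mu>) \<le> K * (r / (4 * K) + r / (4 * K))" using K(1) by (intro mult_left_mono) (auto simp: \<epsilon>_def \<mu>_def)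
    also have "\<dots> < r" using K(1) r by simp
    finally show ?thesis .
  qed
  show ?thesis
  proof (intro exI[of _ "\<epsilon> * \<mu>"] conjI allI impI)
    show "0 < \<epsilon> * \<mu>" using \<epsilon> \<mu> by simp
    fix a b t1 :: real and x i
    assume x: "solution_on \<Omega> \<kappa> (\<lambda>_. G) a b x" and D0: "0 < spread (x a)"
      and drop: "energy G (x a) - energy G (x b) \<le> \<epsilon> * \<mu> * (spread (x a))\<^sup>2" and t1: "t1 \<in> {a..b}"
    define D where "D = spread (x a)"
    define \<phi> where "\<phi> t = max (top_value (x t - x a)) (top_value (x a - x t))" for t
    have contx: "continuous_on {a..b} x" by (rule solution_on_continuous[OF x])
    have conttop: "continuous_on UNIV (top_value :: real ^ 'n \<Rightarrow> real)"
      by (rule continuous_onI) (metis dist_norm dist_real_def le_less_trans top_value_lipschitz norm_minus_commute order_less_imp_le)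
    have cont\<phi>: "continuous_on {a..b} \<phi>"
      unfolding \<phi>_def
      by (intro continuous_intros continuous_on_compose2[OF conttop] contx) auto
    have comp: "\<bar>x t $ j - x a $ j\<bar> \<le> \<phi> t" for t j
      using le_top_value[of "x t - x a" j] le_top_value[of "x a - x t" j] by (simp add: \<phi>_def)
    have "\<phi> t1 \<le> r * D"
    proof (rule ccontr)
      assume "\<not> \<phi> t1 \<le> r * D"
      then have big: "r * D < \<phi> t1" by simp
      have rD: "r * D > 0" using r D0 by (simp add: D_def)
      have \<phi>a: "\<phi> a = 0" using top_value_attained[of "0 :: real ^ 'n"] by (auto simp: \<phi>_def)
      have "\<exists>t\<ge>a. t \<le> t1 \<and> \<phi> t = r * D"
        using big rD \<phi>a t1 by (intro IVT' continuous_on_subset[OF cont\<phi>]) auto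
      then obtain t2 where t2: "a \<le> t2" "t2 \<le> t1" "\<phi> t2 = r * D" by blast
      have "continuous_on {a..t2} (\<lambda>t. - \<phi> t)"
        using t2 t1 by (intro continuous_intros continuous_on_subset[OF cont\<phi>]) auto
      moreover have "\<exists>t\<in>{a..t2}. - \<phi> t \<le> - (r * D)" using t2 by (intro bexI[of _ t2]) auto
      ultimately obtain d where d: "a \<le> d" "d \<le> t2" "- \<phi> d \<le> - (r * D)"
        "\<And>u. a \<le> u \<Longrightarrow> u < d \<Longrightarrow> - (r * D) < - \<phi> u"
        by (rule first_and_last_time) (meson order_trans)
      (* The first time d at which the displacement from x a reaches r * D. *)
      have \<phi>d: "\<phi> d = r * D"
      proof (rule ccontr)
        assume "\<phi> d \<noteq> r * D"
        then have "r * D < \<phi> d" using d(3) by simp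
        then have "\<exists>t\<ge>a. t \<le> d \<and> \<phi> t = r * D"
          using rD \<phi>a d t2 t1 by (intro IVT' continuous_on_subset[OF cont\<phi>]) auto
        then obtain t where "a \<le> t" "t \<le> d" "\<phi> t = r * D" by blast
        with d(4)[of t] \<open>r * D < \<phi> d\<close> show False by (cases "t = d") auto
      qed
      have \<phi>le: "\<phi> u \<le> r * D" if "u \<in> {a..d}" for u
        using d(4)[of u] \<phi>d that by (cases "u = d") auto
      have db: "d \<le> b" using d t2 t1 by simp
      have xd: "solution_on \<Omega> \<kappa> (\<lambda>_. G) a d x" by (rule solution_on_subinterval[OF x order_refl db])
      (* R is the largest displacement between any two times up to d. *)
      define g where "g = (\<lambda>p. top_value (x (snd p) - x (fst p)))"
      have "continuous_on ({a..d} \<times> {a..d}) g"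
        unfolding g_def
        by (intro continuous_on_compose2[OF conttop] continuous_intros
            continuous_on_compose2[OF solution_on_continuous[OF xd]]) auto
      moreover have "compact ({a..d} \<times> {a..d})" "{a..d} \<times> {a..d} \<noteq> {}"
        using d(1) by (auto intro: compact_Times)
      ultimately obtain p where p: "p \<in> {a..d} \<times> {a..d}" "\<forall>p'\<in>{a..d} \<times> {a..d}. g p' \<le> g p"
        using continuous_attains_sup by metis
      obtain s0 t0 where st0: "p = (s0, t0)" by (cases p)
      define R where "R = g p"
      have R: "\<bar>x t $ j - x s $ j\<bar> \<le> R" if "s \<in> {a..d}" "t \<in> {a..d}" for s t j
      proof -
        have "g (s, t) \<le> R" "g (t, s) \<le> R" using p(2) that by (auto simp: R_def)
        then show ?thesis
          using le_top_value[of "x t - x s" j] le_top_value[of "x s - x t" j] by (simp add: g_def)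
      qed
      have Rbig: "r * D \<le> R"
      proof -
        have "g (a, d) \<le> R" "g (d, a) \<le> R" using p(2) d(1) by (auto simp: R_def)
        then show ?thesis using \<phi>d by (simp add: \<phi>_def g_def max_def split: if_splits)
      qed
      obtain j where j: "(x t0 - x s0) $ j = R"
        using top_value_attained[of "x t0 - x s0"] by (auto simp: R_def g_def st0)
      have disp: "displaced a d x R j"
        unfolding displaced_def using p(1) st0 j by (intro bexI[of _ s0] bexI[of _ t0]) auto
      have win: "cheap_window \<Omega> \<kappa> G a d x (\<epsilon> * D) (\<mu> * D) R"
        unfolding cheap_window_def
      proof (intro conjI xd)
        show "0 < \<epsilon> * D" "0 \<le> \<mu> * D" using \<epsilon> \<mu> D0 by (simp_all add: D_def)
        have "energy G (x b) \<le> energy G (x d)"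
          by (rule energy_nonincreasing[OF solution_on_subinterval[OF x d(1) order_refl] db G \<kappa> \<Omega>])
        then show "energy G (x a) - energy G (x d) \<le> \<epsilon> * D * (\<mu> * D)"
          using drop by (simp add: D_def power2_eq_square mult_ac)
      qed (use R in auto)
      obtain q where q: "e * D \<le> \<bar>consensus_error G (x a) q\<bar>" using e(2) unfolding D_def by blast
      have "\<epsilon> * D \<le> \<bar>consensus_error G (x u) q\<bar>" if u: "u \<in> {a..d}" for u
      proof -
        have "\<bar>consensus_error G (x u - x a) q\<bar> \<le> W * (2 * (r * D))"
        proof -
          have 1: "\<bar>(x u - x a) $ l\<bar> \<le> r * D" for l using comp[of u l] \<phi>le[OF u] by simp
          have "(x u - x a) $ l - (x u - x a) $ q \<le> 2 * (r * D)" for l using 1[of l] 1[of q] by linarith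
          then have "consensus_error G (x u - x a) q \<le> W * (2 * (r * D))"
            unfolding W_def using rD by (intro consensus_error_bound[OF G]) auto
          moreover have "(- (x u - x a)) $ l - (- (x u - x a)) $ q \<le> 2 * (r * D)" for l
            using 1[of l] 1[of q] unfolding vector_uminus_component by linarith
          then have "consensus_error G (- (x u - x a)) q \<le> W * (2 * (r * D))"
            unfolding W_def using rD by (intro consensus_error_bound[OF G]) auto
          ultimately show ?thesis unfolding consensus_error_uminus by linarith
        qed
        also have "\<dots> = 2 * W * r * D" by simp
        also have "\<dots> \<le> e / 2 * D" using Wr D0 by (intro mult_right_mono) (auto simp: D_def)
        finally have "e * D - e / 2 * D \<le> \<bar>consensus_error G (x u) q\<bar>"
          using q unfolding consensus_error_diff by linarith
        moreover have "\<epsilon> * D \<le> e / 2 * D" using \<epsilon> D0 by (intro mult_right_mono) (auto simp: D_def)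
        moreover have "e * D - e / 2 * D = e / 2 * D" by (simp add: field_simps)
        ultimately show ?thesis by linarith
      qed
      then have "R \<le> K * (\<epsilon> * D + \<mu> * D)" using K(2)[OF win _ disp] by blast
      also have "\<dots> = K * (\<epsilon> + \<mu>) * D" by (simp add: algebra_simps)
      also have "\<dots> < r * D" using Kr D0 by (intro mult_strict_right_mono) (auto simp: D_def)
      finally show False using Rbig by simp
    qed
    also have "\<dots> \<le> \<rho> * D" using r D0 by (intro mult_right_mono) (auto simp: D_def)
    finally show "\<bar>x t1 $ i - x a $ i\<bar> \<le> \<rho> * spread (x a)" using comp[of t1 i] by (simp add: D_def)
  qed
qed

text \<open>
  Once the component is at most \<open>L\<close> it cannot exceed \<open>L\<close> again, and before that it falls with speed at
  least \<open>r\<close>. The last time at which it is at most \<open>L\<close>, if there is one, separates the two cases.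
\<close>

lemma pushed_below:
  assumes x: "solution_on \<Omega> \<kappa> X a b x" and ab: "a \<le> b" and r: "0 \<le> r"
    and push: "\<And>t. \<lbrakk>t \<in> {a<..<b}; L < x t $ j\<rbrakk> \<Longrightarrow> protocol \<Omega> \<kappa> (X t) (x t) $ j \<le> - r"
  shows "x b $ j \<le> max L (x a $ j - r * (b - a))"
proof -
  have bound: "x b $ j - x s $ j \<le> - r * (b - s)" if s: "a \<le> s" "s \<le> b" and above: "\<And>t. t \<in> {s<..<b} \<Longrightarrow> L < x t $ j" for s
  proof -
    have xs: "solution_on \<Omega> \<kappa> X s b x" by (rule solution_on_subinterval[OF x s(1) order_refl])
    show ?thesis
    proof (rule solution_growth_bound[OF xs s(2) absolutely_continuous_component[OF xs]])
      fix t assume t: "t \<in> {s<..<b}" and der: "(x has_vector_derivative protocol \<Omega> \<kappa> (X t) (x t)) (at t)"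
      show "grows_at_most_at (- r) (\<lambda>t. x t $ j) t"
        using s t above by (intro grows_at_most_at_deriv[OF solution_on_component_derivative[OF der]] push) auto
    qed
  qed
  show ?thesis
  proof (cases "\<exists>t\<in>{a..b}. x t $ j \<le> L")
    case False
    then have "x b $ j - x a $ j \<le> - r * (b - a)" using ab by (intro bound) (auto simp: not_le)
    then show ?thesis by simp
  next
    case True
    obtain t where t: "a \<le> t" "t \<le> b" "x t $ j \<le> L" "\<And>u. t < u \<Longrightarrow> u \<le> b \<Longrightarrow> L < x u $ j"
      by (rule first_and_last_time[OF solution_on_continuous_component[OF x] True]) (meson order_trans)
    have "x b $ j - x t $ j \<le> - r * (b - t)" using t by (intro bound) auto
    also have "\<dots> \<le> 0" using r t by simp
    finally show ?thesis using t(3) by simp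
  qed
qed

text \<open>
  \<open>M\<close> bounds all agents from above and plays the role of the maximum at the start of the window, \<open>D\<close>
  that of the spread.
\<close>

definition held_down ::
  "(real \<Rightarrow> real) \<Rightarrow> real ^ 'n \<Rightarrow> ('n::finite) wgraph \<Rightarrow> real \<Rightarrow> real \<Rightarrow> (real \<Rightarrow> real ^ 'n) \<Rightarrow> real \<Rightarrow> real \<Rightarrow> 'n \<Rightarrow> bool" where
  "held_down \<Omega> \<kappa> G a b x M D w \<longleftrightarrow> solution_on \<Omega> \<kappa> (\<lambda>_. G) a b x \<and> 0 < D \<and>
     (\<forall>u\<in>{a..b}. \<forall>i. x u $ i \<le> M) \<and> (\<forall>u\<in>{a..b}. x u $ w \<le> M - D / 2)"

text \<open>
  Induction along a path from \<open>w\<close> to \<open>j\<close>, half of the waiting time being used for the last edge.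
  During this half the neighbour \<open>k\<close> is at least \<open>\<delta> * D\<close> below \<open>M\<close>. While \<open>j\<close> is within \<open>\<eta> * D\<close> of \<open>M\<close>
  with \<open>\<eta>\<close> much smaller than \<open>\<delta>\<close>, the pull of \<open>k\<close> outweighs that of all other neighbours, so the error
  of \<open>j\<close> is at most a negative multiple of \<open>D\<close>; as \<open>\<Omega> z / z\<close> is at least \<open>z / C\<close>, the agent falls with a
  speed proportional to \<open>D\<close>. All constants are independent of the solution.
\<close>

lemma low_vertex_pulls_all_down:
  fixes G :: "('n::finite) wgraph"
  assumes G: "weighted_graph G" and con: "connected_graph G" and \<kappa>: "\<forall>i. \<kappa> $ i > 0"
    and \<Omega>: "dyadically_summable \<Omega> C" and T: "T > 0"
  shows "\<exists>\<delta>>0. \<forall>a b x M D t. held_down \<Omega> \<kappa> G a b x M D w \<longrightarrow>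
    t \<in> {a + T..b} \<longrightarrow> x t $ j \<le> M - \<delta> * D"
proof -
  have pos: "\<forall>z>0. \<Omega> z > 0" and C: "C > 0" using \<Omega> by (auto simp: dyadically_summable_def)
  define W where "W = total_weight G"
  have W: "W \<ge> 0" using total_weight_nonneg[OF G] by (simp add: W_def)
  define Q where "Q j T \<delta> \<longleftrightarrow> (\<forall>a b x M D t. held_down \<Omega> \<kappa> G a b x M D w \<longrightarrow>
    t \<in> {a + T..b} \<longrightarrow> x t $ j \<le> M - \<delta> * D)" for j T \<delta>
  have "(w, j) \<in> {(u, v). {u, v} \<in> edges G}\<^sup>*" using con by (simp add: connected_graph_def)
  then have "\<forall>T>0. \<exists>\<delta>>0. Q j T \<delta>"
  proof (induction rule: rtrancl_induct)
    case base
    have "Q w T (1 / 2)" if "T > 0" for T using that by (auto simp: Q_def held_down_def)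
    then show ?case by (intro allI impI exI[of _ "1 / 2"]) simp
  next
    case (step k j)
    show ?case
    proof (intro allI impI)
      fix T :: real assume T: "T > 0"
      then obtain \<delta> where \<delta>: "\<delta> > 0" and Q: "Q k (T / 2) \<delta>" using step.IH[THEN spec[of _ "T / 2"]] by auto
      have jk: "{j, k} \<in> edges G" using step.hyps by (simp add: insert_commute)
      define A where "A = adj G j k"
      have A: "A > 0" unfolding A_def by (rule adj_pos[OF G jk])
      define \<eta> where "\<eta> = A * \<delta> / (2 * (W + 1))"
      have \<eta>: "\<eta> > 0" using A \<delta> W by (simp add: \<eta>_def)
      have W\<eta>: "W * \<eta> \<le> A * \<delta> / 2"
      proof -
        have "W * \<eta> \<le> (W + 1) * \<eta>" using \<eta> by (intro mult_right_mono) auto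
        also have "\<dots> = A * \<delta> / 2" using W by (simp add: \<eta>_def divide_simps)
        finally show ?thesis .
      qed
      define r where "r = \<kappa> $ j * (A * \<delta> / 2) / C"
      have r: "r > 0" using \<kappa> A \<delta> C by (simp add: r_def)
      have "Q j T (min \<eta> (r * (T / 2)))"
        unfolding Q_def
      proof (intro allI impI)
        fix a b M D t :: real and x
        assume held: "held_down \<Omega> \<kappa> G a b x M D w" and t: "t \<in> {a + T..b}"
        have x: "solution_on \<Omega> \<kappa> (\<lambda>_. G) a b x" and D: "0 < D" and M: "\<forall>u\<in>{a..b}. \<forall>i. x u $ i \<le> M"
          using held by (simp_all add: held_down_def)
        have low: "x u $ k \<le> M - \<delta> * D" if "u \<in> {a + T / 2..b}" for u
          using Q[unfolded Q_def, rule_format, OF held that] .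
        have xs: "solution_on \<Omega> \<kappa> (\<lambda>_. G) (t - T / 2) t x"
          using t T by (intro solution_on_subinterval[OF x]) auto
        have "x t $ j \<le> max (M - \<eta> * D) (x (t - T / 2) $ j - r * D * (t - (t - T / 2)))"
        proof (rule pushed_below[OF xs])
          show "t - T / 2 \<le> t" "0 \<le> r * D" using T r D by simp_all
          fix u assume u: "u \<in> {t - T / 2<..<t}" and above: "M - \<eta> * D < x u $ j"
          have uin: "u \<in> {a..b}" "u \<in> {a + T / 2..b}" using u t T by auto
          have "consensus_error G (x u) j \<le> (\<Sum>l\<in>UNIV. adj G j l * (\<eta> * D) - (if l = k then A * (\<delta> * D) else 0))"
            unfolding consensus_error_adj
          proof (rule sum_mono)
            fix l
            have "x u $ l \<le> M" using M uin by blast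
            have "adj G j l * (x u $ l - x u $ j) \<le> adj G j l * (\<eta> * D - (if l = k then \<delta> * D else 0))"
              using above low[OF uin(2)] \<open>x u $ l \<le> M\<close> by (intro mult_left_mono adj_nonneg[OF G]) auto
            then show "adj G j l * (x u $ l - x u $ j) \<le> adj G j l * (\<eta> * D) - (if l = k then A * (\<delta> * D) else 0)"
              by (simp add: A_def right_diff_distrib split: if_splits)
          qed
          also have "\<dots> = (\<Sum>l\<in>UNIV. adj G j l) * (\<eta> * D) - A * (\<delta> * D)"
            by (simp add: sum_subtractf sum_distrib_right)
          also have "\<dots> \<le> W * (\<eta> * D) - A * (\<delta> * D)"
            unfolding W_def using \<eta> D by (intro diff_right_mono mult_right_mono degree_le_total_weight[OF G]) auto
          also have "\<dots> = (W * \<eta> - A * \<delta>) * D" by (simp add: algebra_simps)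
          also have "\<dots> \<le> - (A * \<delta> / 2) * D" using W\<eta> D by (intro mult_right_mono) auto
          finally have e: "consensus_error G (x u) j \<le> - (A * \<delta> / 2 * D)" by simp
          define z where "z = - consensus_error G (x u) j"
          have z: "A * \<delta> / 2 * D \<le> z" using e by (simp add: z_def)
          moreover have "0 < A * \<delta> / 2 * D" using A \<delta> D by simp
          ultimately have z0: "0 < z" by linarith
          have "\<kappa> $ j * (z / C) \<le> \<kappa> $ j * (\<Omega> z / z)"
          proof (rule mult_left_mono)
            show "z / C \<le> \<Omega> z / z"
              using dyadically_summable_quadratic[OF \<Omega> z0] z0 C by (simp add: field_simps power2_eq_square)
            show "0 \<le> \<kappa> $ j" using \<kappa> by (simp add: less_imp_le)
          qed
          moreover have "r * D \<le> \<kappa> $ j * (z / C)"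
          proof -
            have "r * D = \<kappa> $ j * ((A * \<delta> / 2 * D) / C)" by (simp add: r_def)
            also have "\<dots> \<le> \<kappa> $ j * (z / C)"
              using z C \<kappa> by (intro mult_left_mono divide_right_mono) (auto simp: less_imp_le)
            finally show ?thesis .
          qed
          moreover have "protocol \<Omega> \<kappa> G (x u) $ j = - (\<kappa> $ j * (\<Omega> z / z))"
            using z0 by (simp add: protocol_def z_def)
          ultimately show "protocol \<Omega> \<kappa> G (x u) $ j \<le> - (r * D)" by simp
        qed
        also have "x (t - T / 2) $ j \<le> M"
        proof -
          have "t - T / 2 \<in> {a..b}" using t T by auto
          then show ?thesis using M by blast
        qed
        then have "max (M - \<eta> * D) (x (t - T / 2) $ j - r * D * (t - (t - T / 2))) \<le>
            max (M - \<eta> * D) (M - r * (T / 2) * D)" by (intro max.mono) (simp_all add: mult_ac)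
        also have "\<dots> = M - min \<eta> (r * (T / 2)) * D"
          using D by (simp add: min_mult_distrib_right max_def min_def)
        finally show "x t $ j \<le> M - min \<eta> (r * (T / 2)) * D" .
      qed
      moreover have "min \<eta> (r * (T / 2)) > 0" using \<eta> r T by simp
      ultimately show "\<exists>\<delta>>0. Q j T \<delta>" by blast
    qed
  qed
  then obtain \<delta> where "\<delta> > 0" "Q j T \<delta>" using T by blast
  then show ?thesis unfolding Q_def by (intro exI[of _ \<delta>] conjI)
qed

text \<open>
  Cut the stretch into \<open>N\<close> equal windows, where \<open>N\<close> depends only on the graph. Unless the spread is
  halved anyway, one window costs so little energy, compared with the square of the spread \<open>E\<close> at its
  start, that no agent moves by more than \<open>E / 2\<close> in it. The lowest agent then remains at least \<open>E / 2\<close>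
  below the initial maximum and pulls all agents away from it, while the minimum does not fall.
\<close>

lemma fixed_graph_contraction:
  fixes G :: "('n::finite) wgraph"
  assumes G: "weighted_graph G" and con: "connected_graph G" and \<kappa>: "\<forall>i. \<kappa> $ i > 0"
    and \<Omega>: "dyadically_summable \<Omega> C" and T: "T > 0"
  shows "\<exists>\<eta>>0. \<forall>a x. solution_on \<Omega> \<kappa> (\<lambda>_. G) a (a + T) x \<longrightarrow>
    spread (x (a + T)) \<le> (1 - \<eta>) * spread (x a)"
proof -
  have pos: "\<forall>z>0. \<Omega> z > 0" using \<Omega> by (auto simp: dyadically_summable_def)
  define W where "W = total_weight G"
  obtain c where c: "c > 0" and still: "\<And>a b x t i. \<lbrakk>solution_on \<Omega> \<kappa> (\<lambda>_. G) a b x; 0 < spread (x a);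
      energy G (x a) - energy G (x b) \<le> c * (spread (x a))\<^sup>2; t \<in> {a..b}\<rbrakk> \<Longrightarrow>
      \<bar>x t $ i - x a $ i\<bar> \<le> 1 / 2 * spread (x a)"
    using cheap_window_stationary[OF G con \<kappa> pos, of "1 / 2"] by fastforce
  obtain N where N: "W / (c / 4) < real N" using reals_Archimedean2 by blast
  have W: "W \<ge> 0" using total_weight_nonneg[OF G] by (simp add: W_def)
  have N0: "real N > 0" using N divide_nonneg_pos[of W "c / 4"] W c by linarith
  have NW: "W < real N * (c / 4)" using N c by (simp add: field_simps)
  define h where "h = T / real N"
  have h: "h > 0" using T N0 by (simp add: h_def)
  have Nh: "real N * h = T" using N0 by (simp add: h_def)
  have "\<forall>w j. \<exists>\<delta>>0. \<forall>a b x M D t. held_down \<Omega> \<kappa> G a b x M D w \<longrightarrow>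
    t \<in> {a + h..b} \<longrightarrow> x t $ j \<le> M - \<delta> * D"
    by (intro allI low_vertex_pulls_all_down[OF G con \<kappa> \<Omega> h])
  then obtain d where dd: "\<forall>w j. d w j > 0 \<and> (\<forall>a b x M D t. held_down \<Omega> \<kappa> G a b x M D w \<longrightarrow>
    t \<in> {a + h..b} \<longrightarrow> x t $ j \<le> M - d w j * D)"
    unfolding choice_iff by (elim exE)
  have d: "d w j > 0" for w j using dd[THEN spec, THEN spec, THEN conjunct1] .
  have down: "x t $ j \<le> M - d w j * D" if "held_down \<Omega> \<kappa> G a b x M D w" "t \<in> {a + h..b}" for w j a b x M D t
    using dd[THEN spec, THEN spec, THEN conjunct2, rule_format, OF that] .
  define \<delta> where "\<delta> = Min (range (\<lambda>(w, j). d w j))"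
  have \<delta>: "\<delta> > 0" "\<And>w j. \<delta> \<le> d w j" using d by (auto simp: \<delta>_def intro!: Min_le)
  define \<eta> where "\<eta> = min \<delta> (1 / 2)"
  have \<eta>: "\<eta> > 0" "\<eta> \<le> 1 / 2" "\<eta> \<le> \<delta>" using \<delta>(1) by (simp_all add: \<eta>_def)
  show ?thesis
  proof (intro exI[of _ \<eta>] conjI \<eta>(1) allI impI)
    fix a x assume x: "solution_on \<Omega> \<kappa> (\<lambda>_. G) a (a + T) x"
    define D where "D = spread (x a)"
    define s where "s k = a + real k * h" for k :: nat
    have sN: "s N = a + T" using Nh by (simp add: s_def)
    have s_in: "a \<le> s k" for k using h by (simp add: s_def)
    have s_mono: "s k \<le> s l" if "k \<le> l" for k l using h that by (simp add: s_def)
    have dec: "spread (x v) \<le> spread (x u)" if "a \<le> u" "u \<le> v" "v \<le> a + T" for u v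
      using spread_nonincreasing[OF solution_on_subinterval[OF x that(1,3)] that(2) _ \<kappa> pos] G by simp
    show "spread (x (a + T)) \<le> (1 - \<eta>) * spread (x a)"
    proof (cases "spread (x (a + T)) \<le> D / 2")
      case True
      also have "D / 2 \<le> (1 - \<eta>) * D" using mult_right_mono[of "1/2" "1 - \<eta>" D] \<eta>(2) spread_nonneg[of "x a"]
        by (simp add: D_def)
      finally show ?thesis by (simp add: D_def)
    next
      case False
      then have half: "D / 2 < spread (x (a + T))" by simp
      have Dn: "D \<ge> 0" by (simp add: D_def spread_nonneg)
      have sp: "D / 2 < spread (x (s k))" if "k \<le> N" for k
        using dec[of "s k" "s N"] s_in[of k] s_mono[OF that] half sN by simp
      have "spread (x (a + T)) \<le> D" using dec[of a "a + T"] T by (simp add: D_def)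
      then have D0: "D > 0" using half Dn by (cases "D = 0") auto
      (* Otherwise N windows would use up more than the initial energy, which is at most W * D^2. *)
      have "\<exists>k<N. energy G (x (s k)) - energy G (x (s (Suc k))) \<le> c * (spread (x (s k)))\<^sup>2"
      proof (rule ccontr)
        assume no: "\<not> ?thesis"
        have "c / 4 * D\<^sup>2 \<le> energy G (x (s k)) - energy G (x (s (Suc k)))" if "k < N" for k
        proof -
          have "(D / 2)\<^sup>2 \<le> (spread (x (s k)))\<^sup>2" using sp[of k] that D0 by (intro power_mono) auto
          then have "c * (D / 2)\<^sup>2 \<le> c * (spread (x (s k)))\<^sup>2" using c by simp
          then show ?thesis using no that by (force simp: power_divide)
        qed
        then have "(\<Sum>k<N. c / 4 * D\<^sup>2) \<le> (\<Sum>k<N. energy G (x (s k)) - energy G (x (s (Suc k))))"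
          by (intro sum_mono) auto
        also have "\<dots> = energy G (x a) - energy G (x (s N))"
          using sum_lessThan_telescope'[of "\<lambda>k. energy G (x (s k))" N] by (simp add: s_def)
        also have "\<dots> \<le> W * D\<^sup>2"
          using energy_le_spread[OF G, of "x a"] energy_nonneg[OF G, of "x (s N)"] by (simp add: W_def D_def)
        finally have "real N * (c / 4) * D\<^sup>2 \<le> W * D\<^sup>2" by simp
        then show False using NW D0 by simp
      qed
      then obtain k where k: "k < N" and drop: "energy G (x (s k)) - energy G (x (s (Suc k))) \<le> c * (spread (x (s k)))\<^sup>2"
        by blast
      define u where "u = s k"
      have u: "a \<le> u" "u + h = s (Suc k)" "u + h \<le> a + T"
        using s_in[of k] s_mono[of "Suc k" N] k sN by (auto simp: u_def s_def algebra_simps)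
      define E where "E = spread (x u)"
      have E: "E > 0" "E \<le> D" using sp[of k] k D0 dec[of a u] u h by (auto simp: E_def u_def D_def)
      define M where "M = top_value (x u)"
      have xu: "solution_on \<Omega> \<kappa> (\<lambda>_. G) u (u + h) x" by (rule solution_on_subinterval[OF x u(1,3)])
      obtain v w where w: "spread (x u) = x u $ v - x u $ w" "x u $ v = top_value (x u)"
        using spread_attained by blast
      have low: "x t $ w \<le> M - E / 2" if "t \<in> {u..u + h}" for t
      proof -
        have "\<bar>x t $ w - x u $ w\<bar> \<le> 1 / 2 * E"
          unfolding E_def using E(1) drop that u(2) by (intro still[OF xu]) (auto simp: E_def u_def)
        then have "x t $ w \<le> x u $ w + E / 2" by linarith
        moreover have "x u $ w = M - E" using w by (simp add: M_def E_def)
        ultimately show ?thesis by (simp add: field_simps)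
      qed
      have M: "x t $ i \<le> M" if "t \<in> {u..u + h}" for t i
      proof -
        have t: "u \<le> t" "t \<le> u + h" using that by auto
        have "top_value (x t) \<le> M"
          unfolding M_def
          using top_value_nonincreasing[OF solution_on_subinterval[OF xu order_refl t(2)] t(1) _ \<kappa> pos] G by simp
        then show ?thesis using le_top_value[of "x t" i] by simp
      qed
      have "x (u + h) $ j \<le> M - \<delta> * E" for j
      proof -
        have "x (u + h) $ j \<le> M - d w j * E"
        proof (rule down)
          show "held_down \<Omega> \<kappa> G u (u + h) x M E w" using xu E(1) M low by (simp add: held_down_def)
        qed (use h in simp)
        also have "\<dots> \<le> M - \<delta> * E" using \<delta>(2)[of w j] E(1) by simp
        finally show ?thesis .
      qed
      then have "top_value (x (u + h)) \<le> M - \<delta> * E" by (simp add: top_value_le_iff)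
      moreover have "top_value (- x (u + h)) \<le> top_value (- x u)"
        using top_value_nonincreasing[OF solution_on_uminus[OF xu] _ _ \<kappa> pos] G h by simp
      ultimately have "spread (x (u + h)) \<le> (1 - \<delta>) * E"
        by (simp add: spread_def E_def M_def algebra_simps)
      also have "\<dots> \<le> (1 - \<eta>) * E" using \<eta>(3) E(1) by (intro mult_right_mono) auto
      also have "\<dots> \<le> (1 - \<eta>) * D" using \<eta>(2) E by (intro mult_left_mono) auto
      finally have "spread (x (u + h)) \<le> (1 - \<eta>) * D" .
      moreover have "spread (x (a + T)) \<le> spread (x (u + h))" using u h by (intro dec) auto
      ultimately show ?thesis by (simp add: D_def)
    qed
  qed
qed

section \<open>Arbitrary switching\<close>

text \<open>
  Everything that the behaviour on one graph contributes to the switched network. Uniform constants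
  for a finite family of graphs are obtained by taking the smallest \<open>\<eta>\<close> and \<open>D2\<close> and the largest \<open>D1\<close>.
\<close>

definition progress ::
  "(real \<Rightarrow> real) \<Rightarrow> real ^ 'n \<Rightarrow> ('n::finite) wgraph \<Rightarrow> real \<Rightarrow> real \<Rightarrow> real \<Rightarrow> real \<Rightarrow> bool" where
  "progress \<Omega> \<kappa> G T \<eta> D1 D2 \<longleftrightarrow> \<eta> > 0 \<and> D1 > 0 \<and> D2 > 0 \<and>
     (\<forall>a x. solution_on \<Omega> \<kappa> (\<lambda>_. G) a (a + T) x \<longrightarrow>
        spread (x (a + T)) \<le> (1 - \<eta>) * spread (x a) \<and> spread (x (a + T)) \<le> D1 \<and>
        (spread (x a) \<le> D2 \<longrightarrow> spread (x (a + T)) = 0))"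

lemma fixed_graph_progress:
  fixes G :: "('n::finite) wgraph"
  assumes G: "weighted_graph G" and con: "connected_graph G" and \<kappa>: "\<forall>i. \<kappa> $ i > 0"
    and \<Omega>: "dyadically_summable \<Omega> C" and T: "T > 0"
  shows "\<exists>\<eta> D1 D2. progress \<Omega> \<kappa> G T \<eta> D1 D2"
proof -
  obtain \<eta> where \<eta>: "\<eta> > 0" "\<And>a x. solution_on \<Omega> \<kappa> (\<lambda>_. G) a (a + T) x \<Longrightarrow> spread (x (a + T)) \<le> (1 - \<eta>) * spread (x a)"
    using fixed_graph_contraction[OF assms] by blast
  obtain V1 V2 where V: "V1 > 0" "V2 > 0"
    and V1: "\<And>a x. solution_on \<Omega> \<kappa> (\<lambda>_. G) a (a + T) x \<Longrightarrow> energy G (x (a + T)) \<le> V1"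
    and V2: "\<And>a x. \<lbrakk>solution_on \<Omega> \<kappa> (\<lambda>_. G) a (a + T) x; energy G (x a) \<le> V2\<rbrakk> \<Longrightarrow> energy G (x (a + T)) = 0"
    using fixed_graph_descent[OF assms] by blast
  obtain K where K: "K > 0" "\<And>x. spread x \<le> K * sqrt (energy G x)" using spread_le_sqrt_energy[OF G con] by blast
  define W where "W = total_weight G + 1"
  have W: "W > 0" using total_weight_nonneg[OF G] by (simp add: W_def)
  have EW: "energy G x \<le> W * (spread x)\<^sup>2" for x
    using energy_le_spread[OF G, of x] by (simp add: W_def distrib_right add_increasing2)
  have large: "spread (x (a + T)) \<le> K * sqrt V1" if "solution_on \<Omega> \<kappa> (\<lambda>_. G) a (a + T) x" for a x
    using order_trans[OF K(2)[of "x (a + T)"], of "K * sqrt V1"] V1[OF that] K(1) by simp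
  have small: "spread (x (a + T)) = 0"
    if x: "solution_on \<Omega> \<kappa> (\<lambda>_. G) a (a + T) x" and small: "spread (x a) \<le> sqrt (V2 / W)" for a x
  proof -
    have "(spread (x a))\<^sup>2 \<le> (sqrt (V2 / W))\<^sup>2" by (intro power_mono small spread_nonneg)
    also have "\<dots> = V2 / W" using V W by simp
    finally have "W * (spread (x a))\<^sup>2 \<le> V2" using W by (simp add: field_simps)
    then have "energy G (x a) \<le> V2" using EW[of "x a"] by simp
    then have "energy G (x (a + T)) = 0" by (rule V2[OF x])
    then show ?thesis using K(2)[of "x (a + T)"] spread_nonneg[of "x (a + T)"] by simp
  qed
  have "progress \<Omega> \<kappa> G T \<eta> (K * sqrt V1) (sqrt (V2 / W))"
    unfolding progress_def
  proof (intro conjI allI impI)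
    show "K * sqrt V1 > 0" "sqrt (V2 / W) > 0" using K V W by simp_all
  qed (rule \<eta> large small; assumption)+
  then show ?thesis by blast
qed

lemma constant_between_switchings:
  fixes \<sigma> :: "real \<Rightarrow> nat"
  assumes uv: "u < v" and cont: "\<And>t. t \<in> {u<..<v} \<Longrightarrow> isCont \<sigma> t" and r: "\<sigma> ` {u<..<v} \<subseteq> {1..r}"
  shows "\<exists>k\<in>{1..r}. \<forall>t\<in>{u<..<v}. \<sigma> t = k"
proof -
  have "continuous_on {u<..<v} \<sigma>" by (intro continuous_at_imp_continuous_on ballI cont)
  then have con: "connected (\<sigma> ` {u<..<v})" by (rule connected_continuous_image) simp
  define m where "m = (u + v) / 2"
  have m: "m \<in> {u<..<v}" using uv by (simp add: m_def)
  have "{\<sigma> m} \<inter> \<sigma> ` {u<..<v} = {} \<or> (- {\<sigma> m}) \<inter> \<sigma> ` {u<..<v} = {}"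
    by (rule connectedD[OF con]) (auto intro: open_discrete)
  then have "\<sigma> t = \<sigma> m" if "t \<in> {u<..<v}" for t using m that by blast
  moreover have "\<sigma> m \<in> {1..r}" using m r by blast
  ultimately show ?thesis by blast
qed

text \<open>
  At most one switching instant lies in an interval shorter than the dwell time, so one of the two
  halves of \<open>{a<..<a + \<tau> / 2}\<close> contains none.
\<close>

lemma constant_stretch:
  assumes vals: "\<forall>t\<ge>t0. \<sigma> t \<in> {1..r}" and \<tau>: "\<tau> > 0"
    and dwell: "\<forall>s\<in>switching_instants t0 \<sigma>. \<forall>t\<in>switching_instants t0 \<sigma>. s < t \<longrightarrow> \<tau> \<le> t - s"
    and a: "t0 \<le> a"
  shows "\<exists>s\<ge>a. s + \<tau> / 4 \<le> a + \<tau> / 2 \<and> (\<exists>k\<in>{1..r}. \<forall>t\<in>{s<..<s + \<tau> / 4}. \<sigma> t = k)"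
proof -
  have const: "\<exists>k\<in>{1..r}. \<forall>t\<in>{s<..<s + \<tau> / 4}. \<sigma> t = k"
    if "a \<le> s" "\<And>t. t \<in> {s<..<s + \<tau> / 4} \<Longrightarrow> isCont \<sigma> t" for s
  proof (rule constant_between_switchings[OF _ that(2)])
    show "s < s + \<tau> / 4" using \<tau> by simp
    show "\<sigma> ` {s<..<s + \<tau> / 4} \<subseteq> {1..r}"
    proof (rule image_subsetI)
      fix t assume "t \<in> {s<..<s + \<tau> / 4}"
      then have "t0 \<le> t" using that(1) a by simp
      then show "\<sigma> t \<in> {1..r}" using vals by blast
    qed
  qed
  show ?thesis
  proof (cases "\<forall>t\<in>{a<..<a + \<tau> / 4}. isCont \<sigma> t")
    case True
    then have "\<exists>k\<in>{1..r}. \<forall>t\<in>{a<..<a + \<tau> / 4}. \<sigma> t = k" by (intro const) auto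
    then show ?thesis using \<tau> by (intro exI[of _ a] conjI) simp_all
  next
    case False
    then obtain p where p: "a < p" "p < a + \<tau> / 4" "\<not> isCont \<sigma> p" by auto
    have "isCont \<sigma> t" if t: "t \<in> {a + \<tau> / 4<..<a + \<tau> / 4 + \<tau> / 4}" for t
    proof (rule ccontr)
      assume "\<not> isCont \<sigma> t"
      then have "\<tau> \<le> t - p" using dwell p t a by (auto simp: switching_instants_def)
      then show False using t p \<tau> by simp
    qed
    then have "\<exists>k\<in>{1..r}. \<forall>t\<in>{a + \<tau> / 4<..<a + \<tau> / 4 + \<tau> / 4}. \<sigma> t = k"
      using \<tau> by (intro const) simp_all
    then show ?thesis using \<tau> by (intro exI[of _ "a + \<tau> / 4"] conjI) simp_all
  qed
qed

theorem theorem5: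
  fixes r :: nat and F :: "nat \<Rightarrow> ('n::finite) wgraph" and \<sigma> :: "real \<Rightarrow> nat" and t0 :: real
    and \<Omega> :: "real \<Rightarrow> real" and \<kappa> :: "real ^ 'n"
  assumes "CARD('n) \<ge> 2"
    and "switched_network r F t0 \<sigma>"
    and "\<forall>k\<in>{1..r}. connected_graph (F k)"
    and "predefined_time_consensus_function \<Omega>"
    and "\<forall>i. \<kappa> $ i > 0"
  shows "\<exists>Tmax::real. Tmax > 0 \<and>
    (\<forall>x0 x. trajectory \<Omega> \<kappa> F \<sigma> t0 x0 x \<longrightarrow>
       converges_to_consensus x \<and> convergence_time t0 x \<le> ereal Tmax)"
proof -
  have F: "\<forall>k\<in>{1..r}. weighted_graph (F k)" and \<sigma>: "\<forall>t\<ge>t0. \<sigma> t \<in> {1..r}"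
    using assms(2) by (auto simp: switched_network_def switching_signal_def)
  obtain \<tau> where \<tau>: "\<tau> > 0"
    and dwell: "\<forall>s\<in>switching_instants t0 \<sigma>. \<forall>t\<in>switching_instants t0 \<sigma>. s < t \<longrightarrow> \<tau> \<le> t - s"
    using assms(2) unfolding switched_network_def switching_signal_def by blast
  obtain C where \<Omega>: "dyadically_summable \<Omega> C"
    using consensus_function_dyadically_summable[OF assms(4)] by blast
  have pos: "\<forall>z>0. \<Omega> z > 0" using \<Omega> by (simp add: dyadically_summable_def)
  note \<kappa> = assms(5)
  define h where "h = \<tau> / 4"
  have h: "h > 0" using \<tau> by (simp add: h_def)
  have "\<exists>\<eta> D1 D2. progress \<Omega> \<kappa> (F k) h \<eta> D1 D2" if "k \<in> {1..r}" for k
    by (rule fixed_graph_progress[OF F[THEN bspec, OF that] assms(3)[THEN bspec, OF that] \<kappa> \<Omega> h])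
  then obtain \<eta>f D1f D2f where progress: "\<And>k. k \<in> {1..r} \<Longrightarrow> progress \<Omega> \<kappa> (F k) h (\<eta>f k) (D1f k) (D2f k)"
    by metis
  have const: "\<eta>f k > 0 \<and> D2f k > 0" if "k \<in> {1..r}" for k
    using progress[OF that] by (simp add: progress_def)
  have prog: "spread (x (a + h)) \<le> (1 - \<eta>f k) * spread (x a) \<and> spread (x (a + h)) \<le> D1f k \<and>
    (spread (x a) \<le> D2f k \<longrightarrow> spread (x (a + h)) = 0)"
    if "k \<in> {1..r}" "solution_on \<Omega> \<kappa> (\<lambda>_. F k) a (a + h) x" for k a x
    using progress[OF that(1), unfolded progress_def, THEN conjunct2, THEN conjunct2, THEN conjunct2,
        THEN spec, THEN spec, THEN mp, OF that(2)] .
  (* The additional elements make the sets visibly nonempty; 1/2 also keeps 1 - \<eta> positive. *)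
  define \<eta> where "\<eta> = Min (insert (1 / 2) (\<eta>f ` {1..r}))"
  define D1 where "D1 = Max (insert 1 (D1f ` {1..r}))"
  define D2 where "D2 = Min (insert 1 (D2f ` {1..r}))"
  have "\<eta> > 0" unfolding \<eta>_def using const by (subst Min_gr_iff) auto
  moreover have "\<eta> \<le> 1 / 2" unfolding \<eta>_def by (rule Min_le) auto
  moreover have "\<eta> \<le> \<eta>f k" if "k \<in> {1..r}" for k unfolding \<eta>_def using that by (intro Min_le) auto
  ultimately have \<eta>: "\<eta> > 0" "\<eta> \<le> 1 / 2" "\<And>k. k \<in> {1..r} \<Longrightarrow> \<eta> \<le> \<eta>f k" .
  have D1: "\<And>k. k \<in> {1..r} \<Longrightarrow> D1f k \<le> D1" unfolding D1_def by (intro Max_ge) auto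
  have "D2 > 0" unfolding D2_def using const by (subst Min_gr_iff) auto
  moreover have "D2 \<le> D2f k" if "k \<in> {1..r}" for k unfolding D2_def using that by (intro Min_le) auto
  ultimately have D2: "D2 > 0" "\<And>k. k \<in> {1..r} \<Longrightarrow> D2 \<le> D2f k" .
  have "(\<lambda>n. (1 - \<eta>) ^ n * D1) \<longlonglongrightarrow> 0 * D1"
    using \<eta> by (intro tendsto_intros LIMSEQ_realpow_zero) auto
  then have "eventually (\<lambda>n. (1 - \<eta>) ^ n * D1 < D2) sequentially"
    using D2(1) by (auto dest: order_tendstoD(2))
  then obtain N where N: "(1 - \<eta>) ^ N * D1 < D2" by (auto simp: eventually_sequentially)
  (* One window of length 2 * h to get below D1, N windows to get below D2, and one to reach 0. *)
  define Tmax where "Tmax = real (N + 2) * (2 * h)"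
  have Tmax: "Tmax > 0" using h by (simp add: Tmax_def)
  have reach: "x t \<in> consensus_set" if x: "trajectory \<Omega> \<kappa> F \<sigma> t0 x0 x" and t: "t0 + Tmax \<le> t" for x0 x t
  proof -
    have dec: "spread (x v) \<le> spread (x u)" if uv: "t0 \<le> u" "u \<le> v" for u v
      using spread_nonincreasing[OF trajectory_solution_on[OF x uv] uv(2) _ \<kappa> pos] F \<sigma> uv by simp
    define S where "S n = spread (x (t0 + real n * (2 * h)))" for n :: nat
    have step: "S (Suc n) \<le> (1 - \<eta>) * S n \<and> S (Suc n) \<le> D1 \<and> (S n \<le> D2 \<longrightarrow> S (Suc n) = 0)" for n
    proof -
      define a where "a = t0 + real n * (2 * h)"
      have a: "t0 \<le> a" "t0 + real (Suc n) * (2 * h) = a + 2 * h" using h by (simp_all add: a_def algebra_simps)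
      obtain s k where s: "a \<le> s" "s + h \<le> a + 2 * h" and k: "k \<in> {1..r}" "\<forall>t\<in>{s<..<s + h}. \<sigma> t = k"
        using constant_stretch[OF \<sigma> \<tau> dwell a(1)] unfolding h_def by auto
      have "solution_on \<Omega> \<kappa> (\<lambda>t. F (\<sigma> t)) s (s + h) x"
        using a s h by (intro trajectory_solution_on[OF x]) auto
      then have xs: "solution_on \<Omega> \<kappa> (\<lambda>_. F k) s (s + h) x"
        by (rule solution_on_cong) (use k in auto)
      have le: "spread (x s) \<le> S n" "S (Suc n) \<le> spread (x (s + h))"
        using dec[of a s] dec[of "s + h" "a + 2 * h"] a s h by (simp_all add: S_def a_def[symmetric])
      have nn: "0 \<le> spread (x s)" "0 \<le> S (Suc n)" by (simp_all add: spread_nonneg S_def)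
      have "spread (x (s + h)) \<le> (1 - \<eta>f k) * spread (x s)" using prog[OF k(1) xs] by simp
      also have "\<dots> \<le> (1 - \<eta>) * spread (x s)" using \<eta>(3)[OF k(1)] nn by (intro mult_right_mono) auto
      also have "\<dots> \<le> (1 - \<eta>) * S n" using \<eta>(2) le by (intro mult_left_mono) auto
      finally have "S (Suc n) \<le> (1 - \<eta>) * S n" using le by simp
      moreover have "S (Suc n) \<le> D1" using prog[OF k(1) xs] D1[OF k(1)] le by linarith
      moreover have "S (Suc n) = 0" if "S n \<le> D2"
      proof -
        have "spread (x s) \<le> D2f k" using that le D2(2)[OF k(1)] by linarith
        then show ?thesis using prog[OF k(1) xs] le nn by simp
      qed
      ultimately show ?thesis by blast
    qed
    have "S (Suc n) \<le> (1 - \<eta>) ^ n * D1" for n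
    proof (induction n)
      case 0
      then show ?case using step[of 0] by simp
    next
      case (Suc n)
      have "S (Suc (Suc n)) \<le> (1 - \<eta>) * S (Suc n)" using step by blast
      also have "\<dots> \<le> (1 - \<eta>) * ((1 - \<eta>) ^ n * D1)" using Suc \<eta>(2) by (intro mult_left_mono) auto
      finally show ?case by (simp add: mult_ac)
    qed
    from this[of N] have "S (Suc N) \<le> D2" using N by linarith
    then have "S (Suc (Suc N)) = 0" using step by blast
    moreover have "t0 + real (Suc (Suc N)) * (2 * h) = t0 + Tmax" by (simp add: Tmax_def)
    ultimately have "spread (x (t0 + Tmax)) = 0" by (simp add: S_def)
    then have "spread (x t) = 0" using dec[of "t0 + Tmax" t] t Tmax spread_nonneg[of "x t"] by simp
    then show ?thesis by (simp add: spread_eq_0_iff)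
  qed
  show ?thesis
  proof (intro exI[of _ Tmax] conjI Tmax allI impI)
    fix x0 x assume x: "trajectory \<Omega> \<kappa> F \<sigma> t0 x0 x"
    have "eventually (\<lambda>t. infdist (x t) consensus_set = 0) at_top"
      using eventually_ge_at_top[of "t0 + Tmax"] by eventually_elim (simp add: reach[OF x])
    then show "converges_to_consensus x"
      unfolding converges_to_consensus_def by (rule tendsto_eventually)
    show "convergence_time t0 x \<le> ereal Tmax"
      unfolding convergence_time_def using reach[OF x] Tmax by (intro Inf_lower) auto
  qed
qed

end
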